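(* Let $\mathbf F(t)\in\mathbb R^3[t]$ be a truly spatial polynomial direction field of degree $n$ without non-constant real polynomial factors. The space $\mathcal R$ of rational curves $\mathbf r(t)$ of given direction field $\mathbf F(t)$, i.e. satisfying $\mathbf r'(t)\times\mathbf F(t)=0$, allows the decomposition $$\mathcal R=\mathcal P\oplus\bigoplus_{\beta\in\mathbb C}\left(\mathcal N^{\beta}\oplus\bigoplus_{j=-\infty}^{-n-2}\mathcal R^{\beta,j}\right)$$ as a direct sum of the space $\mathcal P$ of polynomial solutions, the spaces $\mathcal R^{\beta,j}$ of regular rational solutions and the spaces $\mathcal N^{\beta}$ of non-regular rational solutions.
   Context: Setting. $\mathbf F(t)\in\mathbb R^3[t]$ is a polynomial vector field of degree $n$ whose three components have no non-constant common factor in $\mathbb R[t]$, and it is truly spatial, i.e. its coefficient vectors span the three-dimensional space. For $\beta\in\mathbb C$ write $\mathbf F(t)=\sum_{j=0}^n\mathbf f_j(t-\beta)^j$, where the $\mathbf f_j$ depend on $\beta$. Every rational curve $\mathbf r(t)\in\mathcal R$ can be written as $$\mathbf r(t)=\int\lambda(t)\mathbf F(t)\,\mathrm dt+\mathbf c \qquad ( * )$$ with a rational function $\lambda(t)\in\mathbb R(t)$ and $\mathbf c\in\mathbb R^3$; only those $\lambda$ for which the integral is rational are admissible. The function $\lambda$ is decomposed by partial fractions into a polynomial in $\mathbb R[t]$ plus terms $\lambda_{i,j}(t-\beta_i)^j$, $j<0$, with complex zeros $\beta_i$ of the denominator and complex coefficients $\lambda_{i,j}$; suitably combining pairs of conjugate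 complex summands gives the real partial fraction decomposition. Normalization. For $\lambda(t)$ a finite combination of powers of $(t-\beta)$, the integral in $( * )$ is normalized so that its expansion in powers of $(t-\beta)$ has zero absolute term (zero coefficient at $(t-\beta)^0$). Spaces. - $\mathcal P$ is the space of all polynomial curves obtained from $( * )$ for $\lambda(t)\in\mathbb R[t]$ and $\mathbf c\in\mathbb R^3$; it contains the three-dimensional space of constant curves. - For $\beta\in\mathbb C$ and an integer $r<-n-1$, $\mathcal R^{\beta,r}$ is the one-dimensional space spanned by the rational curve obtained from $( * )$ for $\lambda(t)=(t-\beta)^r$ and $\mathbf c=0$ (regular rational curves). - For $\beta\in\mathbb C$, $\mathcal N^{\beta}$ is the space of curves obtained from $( * )$ for $\mathbf c=0$ and $\lambda(t)=\sum_{j=-n-1}^{-1}\lambda_j(t-\beta)^j$, where $\lambda_{-n-1},\dots,\lambda_{-1}\in\mathbb C$ are subject to the zero-residuum constraint $\lambda_{-1}\mathbf f_0+\lambda_{-2}\mathbf f_1+\lambda_{-3}\mathbf f_2+\cdots+\lambda_{-n-1}\mathbf f_n=0$, which ensures rationality of the integral (non-regular rational curves). *)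

theory Defs
  imports
    "HOL-Analysis.Analysis"
    "HOL-Computational_Algebra.Computational_Algebra"
begin

subsection \<open>Rational functions and curves\<close>

text \<open>
  The field \<open>\<complex>(t)\<close> is \<^typ>\<open>complex poly fract\<close>. Real rational functions are treated as the
  subfield \<open>\<real>(t)\<close> of \<open>\<complex>(t)\<close>, so that real curves and the complex-valued curves attached to
  complex zeros of a denominator live in one space \<open>\<complex>(t)\<^sup>3\<close>.
\<close>

type_synonym ratfun = "complex poly fract"
type_synonym curve = "ratfun ^ 3"

definition fract_deriv :: "ratfun \<Rightarrow> ratfun" where
  "fract_deriv q =
     (THE d. \<exists>a b. b \<noteq> 0 \<and> q = Fract a b \<and> d = Fract (pderiv a * b - a * pderiv b) (b * b))"

lemma fract_deriv_Fract:
  assumes "b \<noteq> 0"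
  shows "fract_deriv (Fract a b) = Fract (pderiv a * b - a * pderiv b) (b * b)"
  unfolding fract_deriv_def
proof (rule the_equality)
  show "\<exists>a' b'. b' \<noteq> 0 \<and> Fract a b = Fract a' b' \<and>
      Fract (pderiv a * b - a * pderiv b) (b * b) =
      Fract (pderiv a' * b' - a' * pderiv b') (b' * b')"
    using assms by blast
next
  fix q
  assume "\<exists>c d. d \<noteq> 0 \<and> Fract a b = Fract c d \<and> q = Fract (pderiv c * d - c * pderiv d) (d * d)"
  then obtain c d where nz: "d \<noteq> 0" and same: "Fract a b = Fract c d"
    and q: "q = Fract (pderiv c * d - c * pderiv d) (d * d)" by blast
  from same nz assms have eq: "a * d = c * b"
    by (simp add: eq_fract)
  then have "pderiv (a * d) = pderiv (c * b)" by simp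
  then have deq: "pderiv a * d + a * pderiv d - (pderiv c * b + c * pderiv b) = 0"
    by (simp add: pderiv_mult algebra_simps)
  have "(pderiv a * b - a * pderiv b) * (d * d) - (pderiv c * d - c * pderiv d) * (b * b)
      = b * d * (pderiv a * d + a * pderiv d - (pderiv c * b + c * pderiv b))
        - (a * d - c * b) * (b * pderiv d + d * pderiv b)"
    by (simp add: algebra_simps)
  also have "\<dots> = 0" using deq eq by simp
  finally show "q = Fract (pderiv a * b - a * pderiv b) (b * b)"
    using nz assms by (simp add: q eq_fract)
qed

definition curve_deriv :: "curve \<Rightarrow> curve" where
  "curve_deriv r = (\<chi> i. fract_deriv (r $ i))"

text \<open>The library's \<^const>\<open>cross3\<close> is restricted to \<^typ>\<open>real ^ 3\<close>.\<close>

definition curve_cross :: "curve \<Rightarrow> curve \<Rightarrow> curve" where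
  "curve_cross a b =
     vector [a$2 * b$3 - a$3 * b$2, a$3 * b$1 - a$1 * b$3, a$1 * b$2 - a$2 * b$1]"

definition const_curve :: "complex ^ 3 \<Rightarrow> curve" where
  "const_curve c = (\<chi> i. to_fract [:c $ i:])"

abbreviation complex_poly :: "real poly \<Rightarrow> complex poly" where
  "complex_poly \<equiv> map_poly complex_of_real"

definition real_ratfun :: "ratfun \<Rightarrow> bool" where
  "real_ratfun q \<longleftrightarrow>
     (\<exists>a b :: real poly. b \<noteq> 0 \<and> q = Fract (complex_poly a) (complex_poly b))"

definition real_curve :: "curve \<Rightarrow> bool" where
  "real_curve r \<longleftrightarrow> (\<forall>i. real_ratfun (r $ i))"

definition real_poly_curve :: "curve \<Rightarrow> bool" where
  "real_poly_curve r \<longleftrightarrow> (\<forall>i. \<exists>a :: real poly. r $ i = to_fract (complex_poly a))"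

definition cscale :: "complex \<Rightarrow> curve \<Rightarrow> curve" where
  "cscale c r = to_fract [:c:] *s r"

definition rscale :: "real \<Rightarrow> curve \<Rightarrow> curve" where
  "rscale c r = cscale (complex_of_real c) r"

lemma vector_space_cscale: "vector_space cscale"
proof
  fix a b :: complex and x y :: curve
  show "cscale a (x + y) = cscale a x + cscale a y"
    by (simp add: cscale_def vec_eq_iff algebra_simps)
  have "to_fract [:a + b:] = to_fract [:a:] + to_fract [:b:]"
    by (simp flip: to_fract_add)
  then show "cscale (a + b) x = cscale a x + cscale b x"
    by (simp add: cscale_def vec_eq_iff algebra_simps)
  have "to_fract [:a * b:] = to_fract [:a:] * to_fract [:b:]"
    by (simp flip: to_fract_mult)
  then show "cscale a (cscale b x) = cscale (a * b) x"
    by (simp add: cscale_def vec_eq_iff algebra_simps)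
  show "cscale 1 x = x"
    by (simp add: cscale_def vec_eq_iff flip: one_pCons)
qed

lemma vector_space_rscale: "vector_space rscale"
proof -
  interpret vector_space cscale by (rule vector_space_cscale)
  show ?thesis
    by unfold_locales (simp_all add: rscale_def scale_right_distrib scale_left_distrib)
qed

subsection \<open>Direct sums\<close>

definition internal_direct_sum ::
    "('k::field \<Rightarrow> 'v::ab_group_add \<Rightarrow> 'v) \<Rightarrow> 'v set \<Rightarrow> 'i set \<Rightarrow> ('i \<Rightarrow> 'v set) \<Rightarrow> bool" where
  "internal_direct_sum scl S I V \<longleftrightarrow>
     (\<forall>i\<in>I. module.subspace scl (V i)) \<and>
     S = module.span scl (\<Union>i\<in>I. V i) \<and>
     (\<forall>J x. finite J \<and> J \<subseteq> I \<and> (\<forall>i\<in>J. x i \<in> V i) \<and> (\<Sum>i\<in>J. x i) = 0 \<longrightarrow> (\<forall>i\<in>J. x i = 0))"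

subsection \<open>Direction fields\<close>

type_synonym direction_field = "real poly ^ 3"

definition field_degree :: "direction_field \<Rightarrow> nat" where
  "field_degree F = Max (range (\<lambda>i. degree (F $ i)))"

definition truly_spatial :: "direction_field \<Rightarrow> bool" where
  "truly_spatial F \<longleftrightarrow> span (range (\<lambda>j. (\<chi> i. coeff (F $ i) j) :: real ^ 3)) = UNIV"

definition no_common_factor :: "direction_field \<Rightarrow> bool" where
  "no_common_factor F \<longleftrightarrow> (\<forall>d :: real poly. (\<forall>i. d dvd F $ i) \<longrightarrow> degree d = 0)"

definition field_curve :: "direction_field \<Rightarrow> curve" where
  "field_curve F = (\<chi> i. to_fract (complex_poly (F $ i)))"

text \<open>The coefficient vector of \<open>(t - \<beta>)\<^sup>k\<close> in \<open>F\<close>: the coefficient of \<open>t\<^sup>k\<close> in \<open>F(t + \<beta>)\<close>.\<close>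

definition taylor_coeff :: "direction_field \<Rightarrow> complex \<Rightarrow> nat \<Rightarrow> complex ^ 3" where
  "taylor_coeff F \<beta> k = (\<chi> i. coeff (pcompose (complex_poly (F $ i)) [:\<beta>, 1:]) k)"

subsection \<open>Rational curves with a given direction field\<close>

definition rational_curves :: "direction_field \<Rightarrow> curve set" where
  "rational_curves F = {r. real_curve r \<and> curve_cross (curve_deriv r) (field_curve F) = 0}"

text \<open>The additive constant of the integral is accounted for by allowing every primitive.\<close>

definition polynomial_curves :: "direction_field \<Rightarrow> curve set" where
  "polynomial_curves F =
     {r. real_poly_curve r \<and>
         (\<exists>l :: real poly. curve_deriv r = to_fract (complex_poly l) *s field_curve F)}"

definition shift_pow :: "complex \<Rightarrow> int \<Rightarrow> ratfun" where
  "shift_pow \<beta> j = to_fract [:- \<beta>, 1:] powi j"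

text \<open>
  \<open>w\<close> is the integral of \<open>v\<close>, normalized so that its (finite) expansion
  \<open>w = (\<Sum>k. a\<^sub>k (t - \<beta>)\<^sup>k)\<close> has \<open>a\<^sub>0 = 0\<close>.
\<close>

definition normalized_integral :: "complex \<Rightarrow> curve \<Rightarrow> curve \<Rightarrow> bool" where
  "normalized_integral \<beta> v w \<longleftrightarrow>
     curve_deriv w = v \<and>
     (\<exists>a :: int \<Rightarrow> complex ^ 3. finite {k. a k \<noteq> 0} \<and> a 0 = 0 \<and>
        w = (\<Sum>k | a k \<noteq> 0. shift_pow \<beta> k *s const_curve (a k)))"

definition regular_curves :: "direction_field \<Rightarrow> complex \<Rightarrow> int \<Rightarrow> curve set" where
  "regular_curves F \<beta> j =
     module.span cscale {w. normalized_integral \<beta> (shift_pow \<beta> j *s field_curve F) w}"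

definition nonregular_curves :: "direction_field \<Rightarrow> complex \<Rightarrow> curve set" where
  "nonregular_curves F \<beta> =
     (let n = field_degree F in
      {w. \<exists>l :: int \<Rightarrow> complex.
            (\<Sum>k\<le>n. l (- 1 - int k) *s taylor_coeff F \<beta> k) = 0 \<and>
            normalized_integral \<beta>
              ((\<Sum>j = - int n - 1..- 1. to_fract [:l j:] * shift_pow \<beta> j) *s field_curve F) w})"

subsection \<open>The summands\<close>

datatype summand = Polynomial | NonRegular complex | Regular complex int

text \<open>
  Indices of the summands belonging to the points \<open>\<beta> \<in> B\<close>, for a direction field of degree \<open>n\<close>.
\<close>

definition summands :: "nat \<Rightarrow> complex set \<Rightarrow> summand set" where
  "summands n B =
     {Polynomial} \<union> NonRegular ` B \<union> {Regular \<beta> j | \<beta> j. \<beta> \<in> B \<and> j \<le> - int n - 2}"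

text \<open>
  The summands for non-real \<open>\<beta>\<close> consist of complex-valued curves. Over \<open>\<complex>\<close>, the real spaces of
  all rational and of all polynomial curves are therefore replaced by their complexifications, that
  is, by their complex spans in \<open>\<complex>(t)\<^sup>3\<close>.
\<close>

definition complexification :: "curve set \<Rightarrow> curve set" where
  "complexification V = module.span cscale V"

fun complex_summand :: "direction_field \<Rightarrow> summand \<Rightarrow> curve set" where
  "complex_summand F Polynomial = complexification (polynomial_curves F)"
| "complex_summand F (NonRegular \<beta>) = nonregular_curves F \<beta>"
| "complex_summand F (Regular \<beta> j) = regular_curves F \<beta> j"

text \<open>
  Over \<open>\<real>\<close>, the summands of \<open>\<beta>\<close> and \<open>cnj \<beta>\<close> are combined and the real curves in their sum are
  taken; for real \<open>\<beta>\<close> these are just the real curves in the summand of \<open>\<beta>\<close>.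
\<close>

definition real_points :: "curve set \<Rightarrow> curve set \<Rightarrow> curve set" where
  "real_points V W = {r. real_curve r \<and> (\<exists>v\<in>V. \<exists>w\<in>W. r = v + w)}"

fun real_summand :: "direction_field \<Rightarrow> summand \<Rightarrow> curve set" where
  "real_summand F Polynomial = polynomial_curves F"
| "real_summand F (NonRegular \<beta>) =
     real_points (nonregular_curves F \<beta>) (nonregular_curves F (cnj \<beta>))"
| "real_summand F (Regular \<beta> j) =
     real_points (regular_curves F \<beta> j) (regular_curves F (cnj \<beta>) j)"

end

theory Submission
  imports Defs "HOL-Computational_Algebra.Field_as_Ring"
begin

text \<open>
  Writing \<open>r' = \<lambda> F\<close>, the decomposition of \<open>r\<close> is the integrated partial fraction decomposition of
  \<open>\<lambda>\<close>. Everything is read off from the Laurent expansions at the points \<open>\<beta>\<close>, which embed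
  \<open>\<complex>(t)\<close> into \<open>\<complex>((t - \<beta>))\<close>. As a derivative, \<open>\<lambda> F\<close> has no residue at \<open>\<beta>\<close>; since \<open>F\<close> has
  degree \<open>n\<close>, only the powers \<open>(t - \<beta>)\<^sup>j\<close> with \<open>- n - 1 \<le> j \<le> - 1\<close> of \<open>\<lambda>\<close> contribute to this residue,
  so that the principal part of \<open>\<lambda>\<close> splits into a multiplier satisfying the residue condition
  and single powers below \<open>- n - 1\<close>, each of which can be integrated. The sum is direct because
  distinct summands have multipliers with disjoint sets of powers \<open>(t - \<beta>)\<^sup>j\<close>, \<open>j < 0\<close>, and the
  normalization excludes non-zero constants. The real decomposition follows by taking real
  parts, since conjugation maps the summands of \<open>\<beta>\<close> to those of \<open>cnj \<beta>\<close>.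
\<close>

notation fls_nth (infixl "$$" 75)

section \<open>Extending homomorphisms to fraction fields\<close>

locale fract_hom =
  fixes \<phi> :: "'a::idom \<Rightarrow> 'b::field"
  assumes hom_add: "\<phi> (a + b) = \<phi> a + \<phi> b"
    and hom_mult: "\<phi> (a * b) = \<phi> a * \<phi> b"
    and hom_one: "\<phi> 1 = 1"
    and hom_nonzero: "a \<noteq> 0 \<Longrightarrow> \<phi> a \<noteq> 0"
begin

text \<open>Since \<open>\<phi>\<close> keeps denominators nonzero, the quotient is independent of
  the representative. The extension is instantiated twice below: by Laurent expansion and by complex
  conjugation.\<close>

definition lift :: "'a fract \<Rightarrow> 'b" where
  "lift q = (THE d. \<exists>a b. b \<noteq> 0 \<and> q = Fract a b \<and> d = \<phi> a / \<phi> b)"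

lemma hom_zero: "\<phi> 0 = 0"
  using hom_add[of 0 0] by (metis add_0 add_cancel_right_right)

lemma lift_Fract:
  assumes "b \<noteq> 0"
  shows "lift (Fract a b) = \<phi> a / \<phi> b"
  unfolding lift_def
proof (rule the_equality)
  show "\<exists>a' b'. b' \<noteq> 0 \<and> Fract a b = Fract a' b' \<and> \<phi> a / \<phi> b = \<phi> a' / \<phi> b'"
    using assms by blast
next
  fix d
  assume "\<exists>a' b'. b' \<noteq> 0 \<and> Fract a b = Fract a' b' \<and> d = \<phi> a' / \<phi> b'"
  then obtain a' b' where b': "b' \<noteq> 0" "Fract a b = Fract a' b'" "d = \<phi> a' / \<phi> b'"
    by blast
  then have "\<phi> (a * b') = \<phi> (a' * b)"
    using assms by (simp add: eq_fract)
  then show "d = \<phi> a / \<phi> b"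
    unfolding b'(3) using b'(1) assms by (simp add: hom_mult hom_nonzero frac_eq_eq)
qed

lemma lift_to_fract: "lift (to_fract a) = \<phi> a"
  by (simp add: to_fract_def lift_Fract hom_one)

lemma lift_add: "lift (p + q) = lift p + lift q"
proof (cases p; cases q)
  fix a b c d
  assume "p = Fract a b" "b \<noteq> 0" "q = Fract c d" "d \<noteq> 0"
  then show ?thesis
    by (simp add: lift_Fract hom_add hom_mult hom_nonzero add_frac_eq)
qed

lemma lift_mult: "lift (p * q) = lift p * lift q"
proof (cases p; cases q)
  fix a b c d
  assume "p = Fract a b" "b \<noteq> 0" "q = Fract c d" "d \<noteq> 0"
  then show ?thesis
    by (simp add: lift_Fract hom_mult)
qed

lemma lift_zero [simp]: "lift 0 = 0"
  by (simp add: Zero_fract_def lift_Fract hom_zero)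

lemma lift_one [simp]: "lift 1 = 1"
  using lift_to_fract[of 1] by (simp add: hom_one)

lemma lift_uminus: "lift (- q) = - lift q"
  using lift_add[of q "- q"] by (simp add: eq_neg_iff_add_eq_0 add.commute)

lemma lift_diff: "lift (p - q) = lift p - lift q"
  using lift_add[of p "- q"] by (simp add: lift_uminus)

lemma lift_sum: "lift (\<Sum>i\<in>A. f i) = (\<Sum>i\<in>A. lift (f i))"
  by (induction A rule: infinite_finite_induct) (simp_all add: lift_add)

lemma lift_inverse: "lift (inverse q) = inverse (lift q)"
proof (cases "q = 0")
  case False
  then have "lift q * lift (inverse q) = 1"
    by (simp flip: lift_mult)
  then show ?thesis
    by (simp add: inverse_unique)
qed simp

lemma lift_eq_0_iff [simp]: "lift q = 0 \<longleftrightarrow> q = 0"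
proof
  assume "lift q = 0"
  then have "lift (q * inverse q) = 0"
    by (simp add: lift_mult)
  then show "q = 0"
    by (cases "q = 0") simp_all
qed simp

lemma lift_eq_iff: "lift p = lift q \<longleftrightarrow> p = q"
  using lift_eq_0_iff[of "p - q"] by (simp add: lift_diff del: lift_eq_0_iff)

lemma lift_power: "lift (q ^ n) = lift q ^ n"
  by (induction n) (simp_all add: lift_mult)

lemma lift_power_int: "lift (q powi k) = lift q powi k"
  by (simp add: power_int_def lift_power lift_inverse)

end

section \<open>Laurent expansions\<close>

text \<open>After substituting \<open>t + \<beta>\<close> for \<open>t\<close>, the formal variable
  of the series stands for \<open>t - \<beta>\<close>.\<close>

definition shifted_fls :: "complex \<Rightarrow> complex poly \<Rightarrow> complex fls" where
  "shifted_fls \<beta> p = fps_to_fls (fps_of_poly (pcompose p [:\<beta>, 1:]))"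

global_interpretation laurent: fract_hom "shifted_fls \<beta>" for \<beta>
  defines laurent = laurent.lift
proof
  show "shifted_fls \<beta> p \<noteq> 0" if "p \<noteq> 0" for p
  proof -
    have "pcompose p [:\<beta>, 1:] \<noteq> 0"
      using pcompose_eq_0[of p "[:\<beta>, 1:]"] that by auto
    then show ?thesis
      by (simp add: shifted_fls_def fps_of_poly_eq_iff[of _ 0, simplified])
  qed
qed (simp_all add: shifted_fls_def pcompose_add pcompose_mult fps_of_poly_add fps_of_poly_mult
      fls_times_fps_to_fls pcompose_1)

lemma laurent_poly_nth:
  "laurent \<beta> (to_fract p) $$ k = (if k < 0 then 0 else coeff (pcompose p [:\<beta>, 1:]) (nat k))"
  by (simp add: laurent.lift_to_fract shifted_fls_def)

lemma laurent_const: "laurent \<beta> (to_fract [:c:]) = fls_const c"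
  by (simp add: laurent.lift_to_fract shifted_fls_def fps_of_poly_const)

lemma laurent_deriv: "laurent \<beta> (fract_deriv q) = fls_deriv (laurent \<beta> q)"
proof (cases q)
  case (Fract a b)
  let ?L = "shifted_fls \<beta>"
  have pd: "?L (pderiv p) = fls_deriv (?L p)" for p
    by (simp add: shifted_fls_def fls_deriv_fps_to_fls flip: fps_of_poly_pderiv)
       (simp add: pderiv_pcompose pderiv_pCons)
  have nz: "?L b \<noteq> 0"
    using Fract laurent.hom_nonzero by blast
  have md: "?L (x - y) = ?L x - ?L y" for x y
    by (simp add: shifted_fls_def pcompose_diff fps_of_poly_diff)
  have q: "laurent \<beta> q = ?L a / ?L b"
    using Fract by (simp add: laurent.lift_Fract)
  \<comment> \<open>Differentiating the product with the denominator turns the product rule for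
    series into the quotient rule.\<close>
  then have "fls_deriv (laurent \<beta> q * ?L b) = fls_deriv (?L a)"
    using nz by simp
  then have "fls_deriv (laurent \<beta> q) = (fls_deriv (?L a) - laurent \<beta> q * fls_deriv (?L b)) / ?L b"
    using nz by (simp add: field_simps)
  also have "\<dots> = laurent \<beta> (fract_deriv q)"
    using Fract nz unfolding q
    by (simp add: fract_deriv_Fract laurent.lift_Fract md laurent.hom_mult pd field_simps)
  finally show ?thesis ..
qed

lemma laurent_shift_pow: "laurent \<beta> (shift_pow \<beta> k) = fls_X_intpow k"
proof -
  have "laurent \<beta> (to_fract [:- \<beta>, 1:]) = fls_X"
    by (simp add: laurent.lift_to_fract shifted_fls_def pcompose_pCons)
  then show ?thesis
    by (simp add: shift_pow_def laurent.lift_power_int)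
qed

text \<open>At \<open>\<beta>\<close> the factor \<open>t - \<gamma>\<close> has constant term
  \<open>\<beta> - \<gamma> \<noteq> 0\<close>, so it is a unit among the power series and even its
  negative powers have no pole there.\<close>

lemma laurent_shift_pow_other:
  assumes "\<gamma> \<noteq> \<beta>" "m < 0"
  shows "laurent \<beta> (shift_pow \<gamma> k) $$ m = 0"
proof -
  define g where "g = fps_of_poly [:\<beta> - \<gamma>, 1:]"
  have g: "laurent \<beta> (to_fract [:- \<gamma>, 1:]) = fps_to_fls g"
    by (simp add: laurent.lift_to_fract shifted_fls_def pcompose_pCons g_def)
  have "subdegree g = 0"
    using assms by (simp add: g_def subdegree_eq_0_iff)
  then have "inverse (fps_to_fls g) = fps_to_fls (inverse g)"
    by (simp add: fls_inverse_fps_to_fls)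
  then have "\<exists>h. laurent \<beta> (shift_pow \<gamma> k) = fps_to_fls h"
    by (auto simp: shift_pow_def laurent.lift_power laurent.lift_inverse g power_int_def
        simp flip: fps_to_fls_power)
  then show ?thesis
    using assms by auto
qed

lemma laurent_term_nth:
  "laurent \<beta> (to_fract [:c:] * shift_pow \<beta> k) $$ m = (if m = k then c else 0)"
  by (simp add: laurent.lift_mult laurent_const laurent_shift_pow)

lemma laurent_sum_nth:
  assumes "finite K"
  shows "laurent \<beta> (\<Sum>k\<in>K. to_fract [:c k:] * shift_pow \<beta> k) $$ m = (if m \<in> K then c m else 0)"
  using assms by (simp add: laurent.lift_sum fls_nth_sum laurent_term_nth)

lemma laurent_sum_other_nth:
  assumes "\<gamma> \<noteq> \<beta>" "m < 0"
  shows "laurent \<beta> (\<Sum>k\<in>K. to_fract [:c k:] * shift_pow \<gamma> k) $$ m = 0"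
  using assms
  by (simp add: laurent.lift_sum fls_nth_sum laurent.lift_mult laurent_const laurent_shift_pow_other)

text \<open>Expansion is an embedding of fields, so one arbitrary point \<open>\<beta>\<close>
  suffices.\<close>

lemma ratfun_eqI:
  assumes "\<And>k. laurent \<beta> p $$ k = laurent \<beta> q $$ k"
  shows "p = q"
  using assms laurent.lift_eq_iff[of \<beta> p q] by (simp add: fls_eq_iff)

text \<open>These are the Laurent polynomials in \<open>t - \<beta>\<close>; it is the finiteness
  demanded by the normalization of integrals.\<close>

definition laurent_poly_at :: "complex \<Rightarrow> ratfun \<Rightarrow> bool" where
  "laurent_poly_at \<beta> q \<longleftrightarrow> finite {k. laurent \<beta> q $$ k \<noteq> 0}"

lemma laurent_poly_at_add:
  assumes "laurent_poly_at \<beta> p" "laurent_poly_at \<beta> q"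
  shows "laurent_poly_at \<beta> (p + q)"
  unfolding laurent_poly_at_def
  by (rule finite_subset[OF _ finite_UnI[OF assms[unfolded laurent_poly_at_def]]])
     (auto simp: laurent.lift_add)

lemma laurent_poly_at_const_mult:
  assumes "laurent_poly_at \<beta> q"
  shows "laurent_poly_at \<beta> (to_fract [:c:] * q)"
  unfolding laurent_poly_at_def
  by (rule finite_subset[OF _ assms[unfolded laurent_poly_at_def]])
     (auto simp: laurent.lift_mult laurent_const)

lemma laurent_poly_at_0 [simp]: "laurent_poly_at \<beta> 0"
  by (simp add: laurent_poly_at_def)

lemma laurent_poly_at_sum:
  assumes "\<And>i. i \<in> A \<Longrightarrow> laurent_poly_at \<beta> (f i)"
  shows "laurent_poly_at \<beta> (\<Sum>i\<in>A. f i)"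
  using assms by (induction A rule: infinite_finite_induct) (simp_all add: laurent_poly_at_add)

lemma laurent_poly_at_term_mult_poly:
  "laurent_poly_at \<beta> (to_fract [:c:] * shift_pow \<beta> k * to_fract p)"
proof -
  let ?P = "pcompose p [:\<beta>, 1:]"
  have "{m. laurent \<beta> (shift_pow \<beta> k * to_fract p) $$ m \<noteq> 0} \<subseteq> {k..k + int (degree ?P)}"
  proof
    fix m
    assume "m \<in> {m. laurent \<beta> (shift_pow \<beta> k * to_fract p) $$ m \<noteq> 0}"
    then have "m \<ge> k" "coeff ?P (nat (m - k)) \<noteq> 0"
      by (simp_all add: laurent.lift_mult laurent_shift_pow laurent_poly_nth
          fls_X_intpow_times_conv_shift split: if_splits)
    with le_degree[OF this(2)] show "m \<in> {k..k + int (degree ?P)}"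
      by simp
  qed
  then have "laurent_poly_at \<beta> (shift_pow \<beta> k * to_fract p)"
    unfolding laurent_poly_at_def using finite_subset by blast
  then show ?thesis
    using laurent_poly_at_const_mult by (simp add: mult.assoc)
qed

lemma laurent_poly_at_sum_mult_poly:
  "laurent_poly_at \<beta> ((\<Sum>k\<in>K. to_fract [:c k:] * shift_pow \<beta> k) * to_fract p)"
  by (simp add: sum_distrib_right laurent_poly_at_sum laurent_poly_at_term_mult_poly)

section \<open>Derivatives and integrals\<close>

lemma fract_deriv_add: "fract_deriv (p + q) = fract_deriv p + fract_deriv q"
  by (rule ratfun_eqI[of 0]) (simp add: laurent_deriv laurent.lift_add algebra_simps)

lemma fract_deriv_const_mult: "fract_deriv (to_fract [:c:] * q) = to_fract [:c:] * fract_deriv q"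
  by (rule ratfun_eqI[of 0]) (simp add: laurent_deriv laurent.lift_mult laurent_const)

lemma curve_deriv_add: "curve_deriv (x + y) = curve_deriv x + curve_deriv y"
  by (simp add: curve_deriv_def vec_eq_iff fract_deriv_add)

lemma curve_deriv_cscale: "curve_deriv (cscale c x) = cscale c (curve_deriv x)"
  by (simp add: curve_deriv_def cscale_def vec_eq_iff fract_deriv_const_mult)

lemma curve_deriv_zero [simp]: "curve_deriv 0 = 0"
  using curve_deriv_add[of 0 0] by simp

lemma curve_deriv_diff: "curve_deriv (x - y) = curve_deriv x - curve_deriv y"
  using curve_deriv_add[of "x - y" y] by (simp add: algebra_simps)

lemma curve_deriv_sum: "curve_deriv (\<Sum>i\<in>A. f i) = (\<Sum>i\<in>A. curve_deriv (f i))"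
  by (induction A rule: infinite_finite_induct) (simp_all add: curve_deriv_add)

text \<open>The family \<open>a\<close> in the definition is forced: it consists of the Laurent
  coefficients of \<open>w\<close> at \<open>\<beta>\<close>. So the normalization becomes a
  condition on each component, with no existential left.\<close>

lemma normalized_integral_iff:
  "normalized_integral \<beta> v w \<longleftrightarrow>
     curve_deriv w = v \<and> (\<forall>i. laurent_poly_at \<beta> (w $ i) \<and> laurent \<beta> (w $ i) $$ 0 = 0)"
proof (intro iffI conjI allI)
  assume w: "normalized_integral \<beta> v w"
  then show "curve_deriv w = v"
    by (simp add: normalized_integral_def)
  fix i
  from w obtain a :: "int \<Rightarrow> complex ^ 3" where a: "finite {k. a k \<noteq> 0}" "a 0 = 0"
    "w = (\<Sum>k | a k \<noteq> 0. shift_pow \<beta> k *s const_curve (a k))"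
    by (auto simp: normalized_integral_def)
  have "laurent \<beta> (w $ i) $$ m = (if a m \<noteq> 0 then a m $ i else 0)" for m
    using laurent_sum_nth[OF a(1), of \<beta> "\<lambda>k. a k $ i" m] unfolding a(3)
    by (simp add: const_curve_def mult.commute)
  then have *: "laurent \<beta> (w $ i) $$ m = a m $ i" for m
    by simp
  then show "laurent \<beta> (w $ i) $$ 0 = 0"
    using a by simp
  show "laurent_poly_at \<beta> (w $ i)"
    unfolding laurent_poly_at_def * by (rule finite_subset[OF _ a(1)]) auto
next
  assume w: "curve_deriv w = v \<and> (\<forall>i. laurent_poly_at \<beta> (w $ i) \<and> laurent \<beta> (w $ i) $$ 0 = 0)"
  define a :: "int \<Rightarrow> complex ^ 3" where "a k = (\<chi> i. laurent \<beta> (w $ i) $$ k)" for k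
  have "{k. a k \<noteq> 0} = (\<Union>i. {k. laurent \<beta> (w $ i) $$ k \<noteq> 0})"
    by (auto simp: a_def vec_eq_iff)
  then have fin: "finite {k. a k \<noteq> 0}"
    using w by (simp add: laurent_poly_at_def)
  have "w $ i = (\<Sum>k | a k \<noteq> 0. to_fract [:a k $ i:] * shift_pow \<beta> k)" for i
    using fin by (intro ratfun_eqI[of \<beta>]) (auto simp: laurent_sum_nth a_def vec_eq_iff)
  then have "w = (\<Sum>k | a k \<noteq> 0. shift_pow \<beta> k *s const_curve (a k))"
    by (simp add: vec_eq_iff const_curve_def mult.commute)
  moreover have "a 0 = 0"
    using w by (simp add: a_def vec_eq_iff)
  ultimately show "normalized_integral \<beta> v w"
    using w fin unfolding normalized_integral_def by blast
qed

lemma normalized_integral_add: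
  assumes "normalized_integral \<beta> v w" "normalized_integral \<beta> v' w'"
  shows "normalized_integral \<beta> (v + v') (w + w')"
  using assms
  by (auto simp: normalized_integral_iff curve_deriv_add laurent.lift_add laurent_poly_at_add)

lemma normalized_integral_cscale:
  assumes "normalized_integral \<beta> v w"
  shows "normalized_integral \<beta> (cscale c v) (cscale c w)"
  using assms
  by (auto simp: normalized_integral_iff curve_deriv_cscale)
     (auto simp: cscale_def laurent.lift_mult laurent_const laurent_poly_at_const_mult)

lemma normalized_integral_0 [simp]: "normalized_integral \<beta> 0 0"
  by (simp add: normalized_integral_iff)

text \<open>A zero derivative leaves only a constant, and the normalization removes it. This is what
  excludes nonzero constants from the non-polynomial summands.\<close>

lemma normalized_integral_0_unique:
  assumes "normalized_integral \<beta> 0 w"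
  shows "w = 0"
proof -
  have "w $ i = 0" for i
  proof -
    have "fract_deriv (w $ i) = 0"
      using assms by (simp add: normalized_integral_iff curve_deriv_def vec_eq_iff)
    then have "fls_deriv (laurent \<beta> (w $ i)) = 0"
      by (simp flip: laurent_deriv)
    then have "laurent \<beta> (w $ i) = fls_const (laurent \<beta> (w $ i) $$ 0)"
      by (simp add: fls_deriv_eq_0_iff)
    also have "\<dots> = 0"
      using assms by (simp add: normalized_integral_iff)
    finally show ?thesis
      by simp
  qed
  then show ?thesis
    by (simp add: vec_eq_iff)
qed

text \<open>Integration is termwise; the coefficient at exponent -1 is the only obstruction.\<close>

lemma normalized_integral_exists:
  fixes v :: curve
  assumes "\<And>i. laurent_poly_at \<beta> (v $ i)" "\<And>i. laurent \<beta> (v $ i) $$ (- 1) = 0"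
  obtains w where "normalized_integral \<beta> v w"
proof -
  define K where "K i = {k. laurent \<beta> (v $ i) $$ (k - 1) \<noteq> 0}" for i
  have fin: "finite (K i)" for i
  proof -
    have "K i = (\<lambda>k. k + 1) ` {k. laurent \<beta> (v $ i) $$ k \<noteq> 0}"
      unfolding K_def by (auto intro: image_eqI[of _ _ "_ - 1"])
    then show ?thesis
      using assms(1) by (simp add: laurent_poly_at_def)
  qed
  define w :: curve where
    "w = (\<chi> i. \<Sum>k\<in>K i. to_fract [:laurent \<beta> (v $ i) $$ (k - 1) / of_int k:] * shift_pow \<beta> k)"
  \<comment> \<open>For \<open>m = 0\<close> the quotient is 0, division by zero having value 0;
    this is the required absolute term.\<close>
  have nth: "laurent \<beta> (w $ i) $$ m = laurent \<beta> (v $ i) $$ (m - 1) / of_int m" for i m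
    by (simp add: w_def laurent_sum_nth[OF fin]) (simp add: K_def)
  have "fract_deriv (w $ i) = v $ i" for i
  proof (rule ratfun_eqI[of \<beta>])
    fix k
    show "laurent \<beta> (fract_deriv (w $ i)) $$ k = laurent \<beta> (v $ i) $$ k"
    \<comment> \<open>A formal derivative never has a term at exponent -1; there the residue
      assumption on \<open>v\<close> is used.\<close>
    proof (cases "k = - 1")
      case False
      then have "of_int (k + 1) \<noteq> (0 :: complex)"
        by (subst of_int_eq_0_iff) simp
      then show ?thesis
        by (simp add: laurent_deriv nth del: of_int_add)
    qed (simp add: laurent_deriv assms(2))
  qed
  moreover have "laurent_poly_at \<beta> (w $ i)" for i
    unfolding laurent_poly_at_def nth by (rule finite_subset[OF _ fin[of i]]) (auto simp: K_def)
  ultimately have "normalized_integral \<beta> v w"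
    by (simp add: normalized_integral_iff curve_deriv_def vec_eq_iff nth)
  then show thesis ..
qed

section \<open>Partial fractions\<close>

text \<open>\<open>poly b \<beta>\<close> is the constant term of the expanded denominator; being
  nonzero, it makes the denominator invertible as a power series.\<close>

lemma laurent_no_pole:
  assumes "poly b \<beta> \<noteq> 0" "m < 0"
  shows "laurent \<beta> (Fract a b) $$ m = 0"
proof -
  let ?g = "fps_of_poly (pcompose b [:\<beta>, 1:])"
  have "subdegree ?g = 0"
    using assms(1) by (auto simp: subdegree_eq_0_iff coeff_pcompose_0 poly_pcompose simp flip: poly_0_coeff_0)
  then have "inverse (fps_to_fls ?g) = fps_to_fls (inverse ?g)"
    by (simp add: fls_inverse_fps_to_fls)
  moreover have "b \<noteq> 0"
    using assms(1) by auto
  ultimately show ?thesis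
    using assms(2)
    by (simp add: laurent.lift_Fract shifted_fls_def divide_inverse flip: fls_times_fps_to_fls)
qed

lemma finite_poles: "finite {\<beta>. \<exists>m<0. laurent \<beta> q $$ m \<noteq> 0}"
proof (cases q)
  case (Fract a b)
  then have "{\<beta>. \<exists>m<0. laurent \<beta> q $$ m \<noteq> 0} \<subseteq> {\<beta>. poly b \<beta> = 0}"
    using laurent_no_pole by blast
  then show ?thesis
    using Fract poly_roots_finite finite_subset by blast
qed

text \<open>In lowest terms, a root of the denominator where \<open>q\<close> has no pole would be a
  root of the numerator as well. So the denominator has no complex root and is constant by the
  fundamental theorem of algebra.\<close>

lemma no_poles_imp_polynomial:
  assumes "\<And>\<beta> m. m < 0 \<Longrightarrow> laurent \<beta> q $$ m = 0"
  obtains p where "q = to_fract p"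
proof -
  define a b where "a = fst (quot_of_fract q)" and "b = snd (quot_of_fract q)"
  have q: "q = Fract a b" "b \<noteq> 0" and cop: "coprime a b"
    by (simp_all add: a_def b_def coprime_quot_of_fract)
  have "poly b \<beta> \<noteq> 0" for \<beta>
  proof
    assume b0: "poly b \<beta> = 0"
    let ?P = "\<lambda>p. fps_of_poly (pcompose p [:\<beta>, 1:])"
    define h where "h = fls_regpart (laurent \<beta> q)"
    have h: "laurent \<beta> q = fps_to_fls h"
      using assms by (intro fls_eqI) (simp add: h_def)
    have "q * to_fract b = to_fract a"
      using q by (simp add: to_fract_def eq_fract)
    then have "laurent \<beta> q * fps_to_fls (?P b) = fps_to_fls (?P a)"
      by (metis laurent.lift_mult laurent.lift_to_fract shifted_fls_def)
    then have "h * ?P b = ?P a"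
      by (simp add: h flip: fls_times_fps_to_fls)
    \<comment> \<open>Constant terms are compared: the constant term of an expansion at
      \<open>\<beta>\<close> is the value at \<open>\<beta>\<close>.\<close>
    then have "poly a \<beta> = fps_nth h 0 * poly b \<beta>"
      by (metis coeff_pcompose_0 fps_mult_nth_0 fps_of_poly_nth pcompose_coeff_0 poly_0_coeff_0
          poly_pcompose poly_pCons add.right_neutral mult_zero_left)
    then have "poly a \<beta> = 0"
      using b0 by simp
    with b0 have "[:- \<beta>, 1:] dvd a" "[:- \<beta>, 1:] dvd b"
      by (simp_all add: poly_eq_0_iff_dvd)
    then have "is_unit [:- \<beta>, 1:]"
      using cop coprime_common_divisor by blast
    then show False
      by (simp add: is_unit_iff_degree)
  qed
  then have "constant (poly b)"
    using fundamental_theorem_of_algebra by blast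
  then have "degree b = 0"
    by (simp add: constant_degree)
  then obtain c where c: "b = [:c:]"
    by (auto elim: degree_eq_zeroE)
  then have "c \<noteq> 0"
    using q by simp
  then have "q = to_fract (smult (1 / c) a)"
    using q c by (simp add: to_fract_def eq_fract)
  then show thesis ..
qed

text \<open>Keeping only nonzero coefficients makes the index set finite, since a Laurent series has
  finitely many negative exponents; a sum over an infinite set would be 0 by convention.\<close>

definition principal_part :: "complex \<Rightarrow> ratfun \<Rightarrow> ratfun" where
  "principal_part \<beta> q =
     (\<Sum>m | m < 0 \<and> laurent \<beta> q $$ m \<noteq> 0. to_fract [:laurent \<beta> q $$ m:] * shift_pow \<beta> m)"

lemma finite_principal_exponents: "finite {m. m < 0 \<and> laurent \<beta> q $$ m \<noteq> 0}"
proof -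
  obtain N where "\<forall>m<N. laurent \<beta> q $$ m = 0"
    by (elim fls_nth_vanishes_belowE)
  then have "{m. m < 0 \<and> laurent \<beta> q $$ m \<noteq> 0} \<subseteq> {N..0}"
    by (auto simp: not_less[symmetric])
  then show ?thesis
    using finite_subset by blast
qed

lemma laurent_principal_part:
  assumes "m < 0"
  shows "laurent \<gamma> (principal_part \<beta> q) $$ m = (if \<gamma> = \<beta> then laurent \<beta> q $$ m else 0)"
  using assms unfolding principal_part_def
  by (auto simp: laurent_sum_nth[OF finite_principal_exponents] laurent_sum_other_nth)

text \<open>A principal part has no pole outside its own point, so subtracting all of them removes
  every pole and leaves a polynomial.\<close>

lemma partial_fractions:
  obtains p B where "finite B" "q = to_fract p + (\<Sum>\<beta>\<in>B. principal_part \<beta> q)"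
proof -
  define B where "B = {\<beta>. \<exists>m<0. laurent \<beta> q $$ m \<noteq> 0}"
  have fin: "finite B"
    by (simp add: B_def finite_poles)
  have "laurent \<gamma> (q - (\<Sum>\<beta>\<in>B. principal_part \<beta> q)) $$ m = 0" if "m < 0" for \<gamma> m
    using that fin
    by (auto simp: laurent.lift_diff laurent.lift_sum fls_nth_sum laurent_principal_part B_def)
  then obtain p where "q - (\<Sum>\<beta>\<in>B. principal_part \<beta> q) = to_fract p"
    using no_poles_imp_polynomial by blast
  then show thesis
    using that fin by (metis diff_add_cancel)
qed

text \<open>In the Cauchy product, exponent \<open>k\<close> of \<open>p\<close> meets exponent
  \<open>- 1 - k\<close> of \<open>q\<close>. The bound \<open>n\<close> in place of the degree of
  \<open>p\<close> lets the three components of a field share one index range.\<close>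

lemma residue_mult_poly:
  assumes "degree p \<le> n"
  shows "laurent \<beta> (q * to_fract p) $$ (- 1) =
    (\<Sum>k\<le>n. laurent \<beta> q $$ (- 1 - int k) * coeff (pcompose p [:\<beta>, 1:]) k)"
proof -
  let ?P = "pcompose p [:\<beta>, 1:]"
  have deg: "degree ?P \<le> n"
    using degree_pcompose_le[of p "[:\<beta>, 1:]"] assms by simp
  have "laurent \<beta> (to_fract p) = (\<Sum>k\<le>n. fls_const (coeff ?P k) * fls_X_intpow (int k))"
  proof (rule fls_eqI)
    fix m
    \<comment> \<open>A negative \<open>m\<close> matches no \<open>int k\<close>, whereas
      \<open>nat m\<close> would be 0; hence the inner case distinction.\<close>
    have "(\<Sum>k\<le>n. if m = int k then coeff ?P k else 0) =
      (\<Sum>k\<le>n. if k = nat m then if m < 0 then 0 else coeff ?P (nat m) else 0)"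
      by (rule sum.cong) auto
    also have "\<dots> = (if m < 0 then 0 else coeff ?P (nat m))"
      using deg by (auto simp: coeff_eq_0)
    finally show "laurent \<beta> (to_fract p) $$ m =
      (\<Sum>k\<le>n. fls_const (coeff ?P k) * fls_X_intpow (int k)) $$ m"
      by (simp add: laurent_poly_nth fls_nth_sum if_distrib cong: if_cong)
  qed
  then have "laurent \<beta> (q * to_fract p) =
    (\<Sum>k\<le>n. fls_const (coeff ?P k) * (laurent \<beta> q * fls_X_intpow (int k)))"
    by (simp add: laurent.lift_mult sum_distrib_left mult.left_commute)
  then show ?thesis
    by (simp add: fls_nth_sum fls_X_intpow_times_conv_shift mult.commute)
qed

section \<open>Complex conjugation\<close>

lemma map_poly_hom_add:
  assumes "f 0 = 0" "\<And>x y. f (x + y) = f x + f y"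
  shows "map_poly f (p + q) = map_poly f p + map_poly f q"
  using assms by (simp add: poly_eq_iff coeff_map_poly)

lemma map_poly_hom_mult:
  assumes "f 0 = 0" "\<And>x y. f (x + y) = f x + f y" "\<And>x y. f (x * y) = f x * f y"
  shows "map_poly f (p * q) = map_poly f p * map_poly f q"
  using assms sum_comp_morphism[of f, OF assms(1,2)]
  by (simp add: poly_eq_iff coeff_map_poly coeff_mult o_def flip: sum_comp_morphism[of f, OF assms(1,2)])

text \<open>Coefficientwise conjugation, an automorphism of \<complex>(t) with fixed field
  \<real>(t). The embedding \<open>to_fract\<close> supplies the field codomain that the locale asks
  for.\<close>

global_interpretation ratfun_cnj: fract_hom "\<lambda>p. to_fract (map_poly cnj p)"
  defines ratfun_cnj = ratfun_cnj.lift
  by standard (simp_all add: map_poly_hom_add map_poly_hom_mult map_poly_eq_0_iff)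

lemma map_poly_cnj_cnj [simp]: "map_poly cnj (map_poly cnj p) = p"
  by (simp add: poly_eq_iff coeff_map_poly)

lemma map_poly_cnj_complex_poly [simp]: "map_poly cnj (complex_poly p) = complex_poly p"
  by (simp add: poly_eq_iff coeff_map_poly)

lemma map_poly_cnj_fixed:
  assumes "map_poly cnj p = p"
  obtains a where "p = complex_poly a"
proof
  have "cnj (coeff p k) = coeff p k" for k
    using assms by (metis coeff_map_poly complex_cnj_zero)
  then show "p = complex_poly (map_poly Re p)"
    by (simp add: poly_eq_iff coeff_map_poly complex_eq_iff)
qed

lemma ratfun_cnj_Fract:
  assumes "b \<noteq> 0"
  shows "ratfun_cnj (Fract a b) = Fract (map_poly cnj a) (map_poly cnj b)"
  using ratfun_cnj.lift_Fract[OF assms] by (simp only: Fract_conv_to_fract)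

lemma ratfun_cnj_cnj [simp]: "ratfun_cnj (ratfun_cnj q) = q"
proof (cases q)
  case (Fract a b)
  then show ?thesis
    by (simp add: ratfun_cnj_Fract map_poly_eq_0_iff)
qed

lemma ratfun_cnj_deriv: "ratfun_cnj (fract_deriv q) = fract_deriv (ratfun_cnj q)"
proof (cases q)
  case (Fract a b)
  have pd: "map_poly cnj (pderiv p) = pderiv (map_poly cnj p)" for p
    by (simp add: poly_eq_iff coeff_map_poly coeff_pderiv)
  have md: "map_poly cnj (x - y) = map_poly cnj x - map_poly cnj y" for x y
    by (simp add: poly_eq_iff coeff_map_poly)
  show ?thesis
    using Fract
    by (simp add: ratfun_cnj_Fract fract_deriv_Fract map_poly_eq_0_iff pd md map_poly_hom_mult)
qed

lemma ratfun_cnj_const [simp]: "ratfun_cnj (to_fract [:c:]) = to_fract [:cnj c:]"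
  by (simp add: ratfun_cnj.lift_to_fract map_poly_pCons)

lemma ratfun_cnj_shift_pow [simp]: "ratfun_cnj (shift_pow \<beta> k) = shift_pow (cnj \<beta>) k"
  by (simp add: shift_pow_def ratfun_cnj.lift_power_int ratfun_cnj.lift_to_fract map_poly_pCons)

lemma real_ratfun_iff: "real_ratfun q \<longleftrightarrow> ratfun_cnj q = q"
proof
  assume "real_ratfun q"
  then obtain a b :: "real poly" where "b \<noteq> 0" "q = Fract (complex_poly a) (complex_poly b)"
    by (auto simp: real_ratfun_def)
  then show "ratfun_cnj q = q"
    by (simp add: ratfun_cnj_Fract map_poly_eq_0_iff)
next
  assume q: "ratfun_cnj q = q"
  obtain a b where ab: "q = Fract a b" "b \<noteq> 0"
    by (cases q)
  \<comment> \<open>Expanding by the conjugate denominator makes the denominator \<open>B\<close>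
    self-conjugate; a fixed fraction then has a self-conjugate numerator too.\<close>
  define A B where "A = a * map_poly cnj b" and "B = b * map_poly cnj b"
  have nz: "map_poly cnj b \<noteq> 0"
    using ab by (simp add: map_poly_eq_0_iff)
  have qAB: "q = Fract A B" "B \<noteq> 0"
    using ab nz by (simp_all add: A_def B_def eq_fract)
  have B: "map_poly cnj B = B"
    by (simp add: B_def map_poly_hom_mult mult.commute)
  then have "Fract (map_poly cnj A) B = Fract A B"
    using q qAB by (simp add: ratfun_cnj_Fract)
  then have "map_poly cnj A = A"
    using qAB by (simp add: eq_fract)
  then obtain A' where "A = complex_poly A'"
    by (rule map_poly_cnj_fixed)
  moreover from B obtain B' where "B = complex_poly B'"
    by (rule map_poly_cnj_fixed)
  ultimately show "real_ratfun q"
    using qAB unfolding real_ratfun_def by (metis map_poly_0)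
qed

section \<open>Conjugation of curves\<close>

definition curve_cnj :: "curve \<Rightarrow> curve" where
  "curve_cnj x = (\<chi> i. ratfun_cnj (x $ i))"

lemma curve_cnj_add: "curve_cnj (x + y) = curve_cnj x + curve_cnj y"
  by (simp add: curve_cnj_def vec_eq_iff ratfun_cnj.lift_add)

lemma curve_cnj_zero [simp]: "curve_cnj 0 = 0"
  by (simp add: curve_cnj_def vec_eq_iff)

lemma curve_cnj_sum: "curve_cnj (\<Sum>i\<in>A. f i) = (\<Sum>i\<in>A. curve_cnj (f i))"
  by (induction A rule: infinite_finite_induct) (simp_all add: curve_cnj_add)

lemma curve_cnj_vmult: "curve_cnj (q *s x) = ratfun_cnj q *s curve_cnj x"
  by (simp add: curve_cnj_def vec_eq_iff ratfun_cnj.lift_mult)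

lemma curve_cnj_cscale: "curve_cnj (cscale c x) = cscale (cnj c) (curve_cnj x)"
  by (simp add: cscale_def curve_cnj_vmult)

lemma curve_cnj_cnj [simp]: "curve_cnj (curve_cnj x) = x"
  by (simp add: curve_cnj_def vec_eq_iff)

lemma curve_cnj_deriv: "curve_cnj (curve_deriv x) = curve_deriv (curve_cnj x)"
  by (simp add: curve_cnj_def curve_deriv_def vec_eq_iff ratfun_cnj_deriv)

lemma curve_cnj_field_curve [simp]: "curve_cnj (field_curve F) = field_curve F"
  by (simp add: curve_cnj_def field_curve_def vec_eq_iff ratfun_cnj.lift_to_fract)

lemma real_curve_iff: "real_curve x \<longleftrightarrow> curve_cnj x = x"
  by (simp add: real_curve_def real_ratfun_iff curve_cnj_def vec_eq_iff)

text \<open>Conjugating the finite expansion conjugates its coefficients and moves the centre to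
  \<open>cnj \<beta>\<close>; a vanishing absolute term stays zero.\<close>

lemma normalized_integral_cnj:
  assumes "normalized_integral \<beta> v w"
  shows "normalized_integral (cnj \<beta>) (curve_cnj v) (curve_cnj w)"
proof -
  from assms obtain a :: "int \<Rightarrow> complex ^ 3" where a: "finite {k. a k \<noteq> 0}" "a 0 = 0"
    "w = (\<Sum>k | a k \<noteq> 0. shift_pow \<beta> k *s const_curve (a k))" and v: "curve_deriv w = v"
    by (auto simp: normalized_integral_def)
  define a' :: "int \<Rightarrow> complex ^ 3" where "a' k = (\<chi> i. cnj (a k $ i))" for k
  have a0: "a' k = 0 \<longleftrightarrow> a k = 0" for k
    by (simp add: a'_def vec_eq_iff)
  have "curve_cnj (const_curve (a k)) = const_curve (a' k)" for k
    by (simp add: curve_cnj_def const_curve_def a'_def vec_eq_iff)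
  then have "curve_cnj w = (\<Sum>k | a' k \<noteq> 0. shift_pow (cnj \<beta>) k *s const_curve (a' k))"
    by (simp add: a(3) curve_cnj_sum curve_cnj_vmult a0)
  moreover have "finite {k. a' k \<noteq> 0}" "a' 0 = 0"
    using a by (simp_all add: a0)
  ultimately show ?thesis
    using v unfolding normalized_integral_def curve_cnj_deriv[symmetric] by blast
qed

section \<open>Real parts of curves\<close>

interpretation complex_curves: vector_space cscale
  by (rule vector_space_cscale)

interpretation real_curves: vector_space rscale
  by (rule vector_space_rscale)

definition real_part :: "curve \<Rightarrow> curve" where
  "real_part x = cscale (1 / 2) (x + curve_cnj x)"

lemma real_curve_real_part: "real_curve (real_part x)"
  by (simp add: real_curve_iff real_part_def curve_cnj_cscale curve_cnj_add add.commute)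

lemma real_part_add: "real_part (x + y) = real_part x + real_part y"
  by (simp add: real_part_def curve_cnj_add complex_curves.scale_right_distrib algebra_simps)

lemma real_part_zero [simp]: "real_part 0 = 0"
  by (simp add: real_part_def)

lemma cscale_halves: "cscale (1 / 2) x + cscale (1 / 2) x = x"
  using complex_curves.scale_left_distrib[of "1 / 2" "1 / 2" x] by simp

lemma real_part_of_real:
  assumes "real_curve x"
  shows "real_part x = x"
  using assms cscale_halves[of x]
  unfolding real_curve_iff real_part_def complex_curves.scale_right_distrib by simp

text \<open>For \<open>x = a + \<i> b\<close> with real curves \<open>a\<close> and
  \<open>b\<close>, the second term is \<open>\<i> b\<close>, because the real part of
  \<open>\<i> x\<close> is \<open>- b\<close>.\<close>

lemma real_imaginary_decomposition:
  "x = real_part x + cscale (- \<i>) (real_part (cscale \<i> x))"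
proof -
  have "cscale (- \<i>) (real_part (cscale \<i> x)) = cscale (1 / 2) x - cscale (1 / 2) (curve_cnj x)"
    by (simp add: real_part_def curve_cnj_cscale complex_curves.scale_right_distrib
        complex_curves.scale_right_diff_distrib)
  then show ?thesis
    using cscale_halves[of x]
    by (simp add: real_part_def[of x] complex_curves.scale_right_distrib)
qed

section \<open>Curves with a given direction field\<close>

text \<open>For nonzero \<open>F\<close> this turns out to be the complexification of
  \<open>rational_curves F\<close>.\<close>

definition complex_solutions :: "direction_field \<Rightarrow> curve set" where
  "complex_solutions F = {r. \<exists>q. curve_deriv r = q *s field_curve F}"

definition complex_polynomial_solutions :: "direction_field \<Rightarrow> curve set" where
  "complex_polynomial_solutions F = {r. \<exists>p. curve_deriv r = to_fract p *s field_curve F}"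

lemma field_curve_nonzero:
  assumes "truly_spatial F"
  shows "field_curve F \<noteq> 0"
proof
  assume "field_curve F = 0"
  then have "F $ i = 0" for i
    by (simp add: field_curve_def vec_eq_iff map_poly_eq_0_iff)
  then have "range (\<lambda>j. (\<chi> i. coeff (F $ i) j) :: real ^ 3) \<subseteq> {0}"
    by (auto simp: vec_eq_iff)
  then have "span (range (\<lambda>j. (\<chi> i. coeff (F $ i) j) :: real ^ 3)) \<subseteq> span {0}"
    by (rule span_mono)
  then have "(UNIV :: (real ^ 3) set) \<subseteq> {0}"
    using assms by (simp add: truly_spatial_def)
  moreover have "(1 :: real ^ 3) \<noteq> 0"
    by (simp add: vec_eq_iff)
  ultimately show False
    by blast
qed

lemma vmult_eq_iff:
  fixes v :: curve
  assumes "v \<noteq> 0"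
  shows "p *s v = q *s v \<longleftrightarrow> p = q"
  using assms by (auto simp: vec_eq_iff)

lemma curve_cross_eq_0_iff:
  assumes "v \<noteq> 0"
  shows "curve_cross u v = 0 \<longleftrightarrow> (\<exists>q. u = q *s v)"
proof
  assume "\<exists>q. u = q *s v"
  then show "curve_cross u v = 0"
    by (auto simp: curve_cross_def vec_eq_iff forall_3 vector_3)
next
  assume cross: "curve_cross u v = 0"
  have eq: "u $ i * v $ j = u $ j * v $ i" for i j
  proof -
    have "\<forall>i j. u $ i * v $ j = u $ j * v $ i"
      using cross
      by (simp add: curve_cross_def vec_eq_iff forall_3 vector_3 mult.commute)
    then show ?thesis
      by blast
  qed
  \<comment> \<open>A nonzero component of \<open>v\<close> fixes the factor of
    proportionality.\<close>
  from assms obtain j where "v $ j \<noteq> 0"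
    by (auto simp: vec_eq_iff)
  then have "u = (u $ j / v $ j) *s v"
    using eq[of _ j] by (simp add: vec_eq_iff field_simps)
  then show "\<exists>q. u = q *s v" ..
qed

lemma rational_curves_eq:
  assumes "field_curve F \<noteq> 0"
  shows "rational_curves F = {r \<in> complex_solutions F. real_curve r}"
  using curve_cross_eq_0_iff[OF assms]
  by (auto simp: rational_curves_def complex_solutions_def)

lemma cscale_vmult: "cscale c (q *s x) = (to_fract [:c:] * q) *s x"
  by (simp add: cscale_def)

lemma subspace_complex_solutions: "complex_curves.subspace (complex_solutions F)"
proof (rule complex_curves.subspaceI)
  show "0 \<in> complex_solutions F"
    unfolding complex_solutions_def by (auto intro: exI[of _ 0])
  show "x + y \<in> complex_solutions F" if "x \<in> complex_solutions F" "y \<in> complex_solutions F" for x y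
    using that unfolding complex_solutions_def
    by (auto simp: curve_deriv_add simp flip: vector_sadd_rdistrib)
  show "cscale c x \<in> complex_solutions F" if "x \<in> complex_solutions F" for c x
    using that unfolding complex_solutions_def
    by (auto simp: curve_deriv_cscale cscale_vmult)
qed

lemma subspace_complex_polynomial_solutions:
  "complex_curves.subspace (complex_polynomial_solutions F)"
proof (rule complex_curves.subspaceI)
  show "0 \<in> complex_polynomial_solutions F"
    unfolding complex_polynomial_solutions_def by (auto intro: exI[of _ 0])
  show "x + y \<in> complex_polynomial_solutions F"
    if "x \<in> complex_polynomial_solutions F" "y \<in> complex_polynomial_solutions F" for x y
    using that unfolding complex_polynomial_solutions_def
    by (auto simp: curve_deriv_add simp flip: vector_sadd_rdistrib to_fract_add)
  show "cscale c x \<in> complex_polynomial_solutions F" if "x \<in> complex_polynomial_solutions F" for c x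
    using that unfolding complex_polynomial_solutions_def
    by (auto simp: curve_deriv_cscale cscale_vmult simp flip: to_fract_mult)
qed

lemma curve_cnj_complex_solutions:
  assumes "x \<in> complex_solutions F"
  shows "curve_cnj x \<in> complex_solutions F"
  using assms unfolding complex_solutions_def
  by (auto simp: curve_cnj_vmult simp flip: curve_cnj_deriv)

lemma curve_cnj_complex_polynomial_solutions:
  assumes "x \<in> complex_polynomial_solutions F"
  shows "curve_cnj x \<in> complex_polynomial_solutions F"
  using assms unfolding complex_polynomial_solutions_def
  by (auto simp: curve_cnj_vmult ratfun_cnj.lift_to_fract simp flip: curve_cnj_deriv)

lemma real_part_mem:
  assumes "complex_curves.subspace V" "x \<in> V" "curve_cnj x \<in> V"
  shows "real_part x \<in> V"
  using assms
  by (simp add: real_part_def complex_curves.subspace_add complex_curves.subspace_scale)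

text \<open>A subspace stable under conjugation contains both real curves of
  \<open>real_imaginary_decomposition\<close>, so its real members span it.\<close>

lemma complexification_real_curves:
  assumes "complex_curves.subspace V" "\<And>x. x \<in> V \<Longrightarrow> curve_cnj x \<in> V"
  shows "complexification {x \<in> V. real_curve x} = V"
proof (rule antisym)
  show "complexification {x \<in> V. real_curve x} \<subseteq> V"
    unfolding complexification_def by (rule complex_curves.span_minimal) (use assms in auto)
  show "V \<subseteq> complexification {x \<in> V. real_curve x}"
  proof
    fix x
    assume x: "x \<in> V"
    have "real_part x \<in> V" "real_part (cscale \<i> x) \<in> V"
      using assms x complex_curves.subspace_scale by (simp_all add: real_part_mem)
    then have "real_part x \<in> {x \<in> V. real_curve x}"
      "real_part (cscale \<i> x) \<in> {x \<in> V. real_curve x}"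
      by (simp_all add: real_curve_real_part)
    then show "x \<in> complexification {x \<in> V. real_curve x}"
      unfolding complexification_def
      by (subst real_imaginary_decomposition[of x])
        (intro complex_curves.span_add complex_curves.span_scale complex_curves.span_base)
  qed
qed

lemma complexification_rational_curves:
  assumes "field_curve F \<noteq> 0"
  shows "complexification (rational_curves F) = complex_solutions F"
  unfolding rational_curves_eq[OF assms]
  by (intro complexification_real_curves subspace_complex_solutions curve_cnj_complex_solutions)

text \<open>A pole of \<open>r\<close> would be a pole of \<open>r'\<close>.\<close>

lemma complex_polynomial_solution_is_polynomial:
  fixes r :: curve
  assumes "r \<in> complex_polynomial_solutions F"
  obtains p where "r $ i = to_fract p"
proof -
  from assms obtain l where l: "curve_deriv r = to_fract l *s field_curve F"
    by (auto simp: complex_polynomial_solutions_def)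
  then have "fract_deriv (r $ i) = to_fract (l * complex_poly (F $ i))"
    by (simp add: curve_deriv_def field_curve_def vec_eq_iff)
  then have "fls_deriv (laurent \<beta> (r $ i)) $$ (m - 1) = 0" if "m < 0" for \<beta> m
    using that by (simp add: laurent_poly_nth flip: laurent_deriv del: to_fract_mult)
  then have "laurent \<beta> (r $ i) $$ m = 0" if "m < 0" for \<beta> m
    using that by fastforce
  then show thesis
    using no_poles_imp_polynomial that by blast
qed

lemma polynomial_curves_eq:
  assumes "field_curve F \<noteq> 0"
  shows "polynomial_curves F = {r \<in> complex_polynomial_solutions F. real_curve r}"
proof (rule antisym; rule subsetI)
  fix r
  assume r: "r \<in> polynomial_curves F"
  have "ratfun_cnj (r $ i) = r $ i" for i
  proof -
    from r obtain a where "r $ i = to_fract (complex_poly a)"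
      unfolding polynomial_curves_def real_poly_curve_def by blast
    then show ?thesis
      by (simp add: ratfun_cnj.lift_to_fract)
  qed
  then show "r \<in> {r \<in> complex_polynomial_solutions F. real_curve r}"
    using r
    by (auto simp: polynomial_curves_def complex_polynomial_solutions_def real_curve_iff
        curve_cnj_def vec_eq_iff)
next
  fix r
  assume r: "r \<in> {r \<in> complex_polynomial_solutions F. real_curve r}"
  have "\<exists>a. r $ i = to_fract (complex_poly a)" for i
  proof -
    from r have "r \<in> complex_polynomial_solutions F"
      by simp
    then obtain p where p: "r $ i = to_fract p"
      by (rule complex_polynomial_solution_is_polynomial)
    have "ratfun_cnj (r $ i) = r $ i"
      using r by (simp add: real_curve_def real_ratfun_iff)
    then have "map_poly cnj p = p"
      by (simp add: p ratfun_cnj.lift_to_fract)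
    then obtain a where "p = complex_poly a"
      by (rule map_poly_cnj_fixed)
    with p show ?thesis
      by blast
  qed
  moreover from r obtain l where l: "curve_deriv r = to_fract l *s field_curve F"
    by (auto simp: complex_polynomial_solutions_def)
  \<comment> \<open>Conjugating \<open>r' = l F\<close> fixes \<open>r'\<close> and
    \<open>F\<close>, and \<open>F \<noteq> 0\<close> determines the multiplier; so \<open>l\<close>
    is real.\<close>
  moreover have "map_poly cnj l = l"
  proof -
    have "curve_cnj (curve_deriv r) = curve_deriv r"
      using r by (simp add: curve_cnj_deriv real_curve_iff)
    then have "to_fract (map_poly cnj l) *s field_curve F = to_fract l *s field_curve F"
      by (simp add: l curve_cnj_vmult ratfun_cnj.lift_to_fract)
    then show ?thesis
      using assms by (simp add: vmult_eq_iff)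
  qed
  then obtain a where "l = complex_poly a"
    by (rule map_poly_cnj_fixed)
  ultimately show "r \<in> polynomial_curves F"
    unfolding polynomial_curves_def real_poly_curve_def by blast
qed

lemma complexification_polynomial_curves:
  assumes "field_curve F \<noteq> 0"
  shows "complexification (polynomial_curves F) = complex_polynomial_solutions F"
  unfolding polynomial_curves_eq[OF assms]
  by (intro complexification_real_curves subspace_complex_polynomial_solutions
      curve_cnj_complex_polynomial_solutions)

section \<open>The summands\<close>

lemma degree_field:
  "degree (complex_poly (F $ i)) \<le> field_degree F"
proof -
  have "degree (F $ i) \<le> field_degree F"
    unfolding field_degree_def by (rule Max_ge) auto
  then show ?thesis
    using degree_map_poly[of complex_of_real "F $ i"] by simp
qed

text \<open>By the convolution formula for residues, the zero-residuum constraint says, component by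
  component, that the integrand has no term at exponent -1.\<close>

lemma residue_condition_iff:
  "(\<Sum>k\<le>field_degree F. laurent \<beta> q $$ (- 1 - int k) *s taylor_coeff F \<beta> k) = 0 \<longleftrightarrow>
     (\<forall>i. laurent \<beta> ((q *s field_curve F) $ i) $$ (- 1) = 0)"
  by (simp add: vec_eq_iff field_curve_def taylor_coeff_def residue_mult_poly[OF degree_field])

text \<open>Common shape of the multipliers at one point: \<open>K\<close> is
  \<open>{- n - 1..- 1}\<close> for nonregular and \<open>{j}\<close> for regular curves, so both
  kinds are treated together.\<close>

definition local_multiplier :: "complex \<Rightarrow> int set \<Rightarrow> (int \<Rightarrow> complex) \<Rightarrow> ratfun" where
  "local_multiplier \<beta> K c = (\<Sum>k\<in>K. to_fract [:c k:] * shift_pow \<beta> k)"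

lemma laurent_local_multiplier:
  assumes "finite K"
  shows "laurent \<beta> (local_multiplier \<beta> K c) $$ m = (if m \<in> K then c m else 0)"
  using assms by (simp add: local_multiplier_def laurent_sum_nth)

lemma local_multiplier_integral:
  assumes "finite K" "\<And>i. laurent \<beta> ((local_multiplier \<beta> K c *s field_curve F) $ i) $$ (- 1) = 0"
  obtains w where "normalized_integral \<beta> (local_multiplier \<beta> K c *s field_curve F) w"
proof (rule normalized_integral_exists)
  show "laurent_poly_at \<beta> ((local_multiplier \<beta> K c *s field_curve F) $ i)" for i
    by (simp add: local_multiplier_def field_curve_def laurent_poly_at_sum_mult_poly)
qed (use assms that in auto)

text \<open>A derivative has no residue, so the existence of the integral forces the zero-residuum
  constraint. Nonregular curves thereby get the same form as regular ones.\<close>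

lemma nonregular_curves_eq:
  assumes "field_degree F = n"
  shows "nonregular_curves F \<beta> = {w. \<exists>c.
    normalized_integral \<beta> (local_multiplier \<beta> {- int n - 1..- 1} c *s field_curve F) w}"
proof -
  let ?K = "{- int n - 1..- 1}"
  have "(\<Sum>k\<le>n. c (- 1 - int k) *s taylor_coeff F \<beta> k) = 0"
    if "normalized_integral \<beta> (local_multiplier \<beta> ?K c *s field_curve F) w" for c w
  proof -
    let ?q = "local_multiplier \<beta> ?K c"
    have "(?q *s field_curve F) $ i = fract_deriv (w $ i)" for i
      using that by (auto simp: normalized_integral_def curve_deriv_def vec_eq_iff)
    then have "laurent \<beta> ((?q *s field_curve F) $ i) $$ (- 1) = 0" for i
      by (simp add: laurent_deriv del: vector_smult_component)
    then have "(\<Sum>k\<le>n. laurent \<beta> ?q $$ (- 1 - int k) *s taylor_coeff F \<beta> k) = 0"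
      using residue_condition_iff assms by blast
    then show ?thesis
      by (simp add: laurent_local_multiplier)
  qed
  then show ?thesis
    unfolding nonregular_curves_def local_multiplier_def by (auto simp: Let_def assms)
qed

lemma local_multiplier_add:
  "local_multiplier \<beta> K (\<lambda>k. c k + d k) = local_multiplier \<beta> K c + local_multiplier \<beta> K d"
proof -
  have "to_fract [:x + y:] = to_fract [:x:] + to_fract [:y:]" for x y :: complex
    by (simp flip: to_fract_add)
  then show ?thesis
    by (simp add: local_multiplier_def algebra_simps sum.distrib)
qed

lemma local_multiplier_scale:
  "local_multiplier \<beta> K (\<lambda>k. a * c k) = to_fract [:a:] * local_multiplier \<beta> K c"
proof -
  have "to_fract [:x * y:] = to_fract [:x:] * to_fract [:y:]" for x y :: complex
    by (simp flip: to_fract_mult)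
  then show ?thesis
    by (simp add: local_multiplier_def sum_distrib_left mult.assoc)
qed

lemma local_multiplier_zero: "local_multiplier \<beta> K (\<lambda>k. 0) = 0"
  by (simp add: local_multiplier_def)

lemma subspace_local_solutions:
  "complex_curves.subspace {w. \<exists>c.
    normalized_integral \<beta> (local_multiplier \<beta> K c *s field_curve F) w}"
  (is "complex_curves.subspace ?S")
proof (rule complex_curves.subspaceI)
  have "normalized_integral \<beta> (local_multiplier \<beta> K (\<lambda>k. 0) *s field_curve F) 0"
    by (simp add: local_multiplier_zero)
  then show "0 \<in> ?S"
    by blast
  fix x y a
  assume "x \<in> ?S"
  then obtain c where c: "normalized_integral \<beta> (local_multiplier \<beta> K c *s field_curve F) x"
    by blast
  from normalized_integral_cscale[OF this, of a]
  have "normalized_integral \<beta> (local_multiplier \<beta> K (\<lambda>k. a * c k) *s field_curve F) (cscale a x)"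
    by (simp only: cscale_vmult local_multiplier_scale)
  then show "cscale a x \<in> ?S"
    by blast
  assume "y \<in> ?S"
  then obtain d where "normalized_integral \<beta> (local_multiplier \<beta> K d *s field_curve F) y"
    by blast
  from normalized_integral_add[OF c this]
  have "normalized_integral \<beta> (local_multiplier \<beta> K (\<lambda>k. c k + d k) *s field_curve F) (x + y)"
    by (simp only: vector_sadd_rdistrib local_multiplier_add)
  then show "x + y \<in> ?S"
    by blast
qed

lemma regular_curves_eq:
  "regular_curves F \<beta> j = {w. \<exists>c.
    normalized_integral \<beta> (local_multiplier \<beta> {j} c *s field_curve F) w}" (is "_ = ?S")
proof (rule antisym)
  have "local_multiplier \<beta> {j} (\<lambda>_. 1) = shift_pow \<beta> j"
    by (simp add: local_multiplier_def flip: one_pCons)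
  then have "{w. normalized_integral \<beta> (shift_pow \<beta> j *s field_curve F) w} \<subseteq> ?S"
    by (metis (mono_tags, lifting) mem_Collect_eq subsetI)
  then show "regular_curves F \<beta> j \<subseteq> ?S"
    unfolding regular_curves_def
    by (intro complex_curves.span_minimal subspace_local_solutions)
next
  show "?S \<subseteq> regular_curves F \<beta> j"
  proof
    fix w
    assume "w \<in> ?S"
    then obtain c where c:
      "normalized_integral \<beta> ((to_fract [:c j:] * shift_pow \<beta> j) *s field_curve F) w"
      by (auto simp: local_multiplier_def)
    \<comment> \<open>A nonzero coefficient can be scaled to 1, giving a generator of the span; for
      a zero coefficient the normalization forces \<open>w = 0\<close>.\<close>
    show "w \<in> regular_curves F \<beta> j"
    proof (cases "c j = 0")
      case True
      then show ?thesis
        using c normalized_integral_0_unique[of \<beta> w] complex_curves.span_zero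
        by (simp add: regular_curves_def)
    next
      case False
      then have "to_fract [:inverse (c j):] * (to_fract [:c j:] * shift_pow \<beta> j) = shift_pow \<beta> j"
        by (simp flip: mult.assoc to_fract_mult one_pCons)
      then have "normalized_integral \<beta> (shift_pow \<beta> j *s field_curve F) (cscale (inverse (c j)) w)"
        using normalized_integral_cscale[OF c, of "inverse (c j)"] by (simp only: cscale_vmult)
      then have "cscale (c j) (cscale (inverse (c j)) w) \<in> regular_curves F \<beta> j"
        unfolding regular_curves_def
        by (intro complex_curves.span_scale complex_curves.span_base) simp
      then show ?thesis
        using False by simp
    qed
  qed
qed

section \<open>Conjugation of summand indices\<close>

fun summand_cnj :: "summand \<Rightarrow> summand" where
  "summand_cnj Polynomial = Polynomial"
| "summand_cnj (NonRegular \<beta>) = NonRegular (cnj \<beta>)"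
| "summand_cnj (Regular \<beta> j) = Regular (cnj \<beta>) j"

lemma summand_cnj_cnj [simp]: "summand_cnj (summand_cnj i) = i"
  by (cases i) simp_all

lemma mem_summands [simp]:
  "Polynomial \<in> summands n B"
  "NonRegular \<beta> \<in> summands n B \<longleftrightarrow> \<beta> \<in> B"
  "Regular \<beta> j \<in> summands n B \<longleftrightarrow> \<beta> \<in> B \<and> j \<le> - int n - 2"
  by (auto simp: summands_def)

lemma summand_cnj_in_summands:
  assumes "i \<in> summands n UNIV"
  shows "summand_cnj i \<in> summands n UNIV"
  using assms by (cases i) simp_all

text \<open>The only summand whose multipliers may contain the power \<open>(t - \<beta>)\<^sup>m\<close>, \<open>m < 0\<close>.\<close>

definition power_summand :: "nat \<Rightarrow> complex \<Rightarrow> int \<Rightarrow> summand" where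
  "power_summand n \<beta> m = (if m \<ge> - int n - 1 then NonRegular \<beta> else Regular \<beta> m)"

section \<open>The complex decomposition\<close>

context
  fixes F :: direction_field and n :: nat
  assumes degree: "field_degree F = n"
    and nonzero: "field_curve F \<noteq> 0"
begin

lemma complex_summand_Polynomial:
  "complex_summand F Polynomial = complex_polynomial_solutions F"
  by (simp add: complexification_polynomial_curves[OF nonzero])

lemma subspace_complex_summand: "complex_curves.subspace (complex_summand F i)"
proof (cases i)
  case Polynomial
  then show ?thesis
    using complex_summand_Polynomial subspace_complex_polynomial_solutions by simp
next
  case (NonRegular \<beta>)
  then show ?thesis
    by (simp add: nonregular_curves_eq[OF degree] subspace_local_solutions)
next
  case (Regular \<beta> j)
  then show ?thesis
    by (simp add: regular_curves_eq subspace_local_solutions)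
qed

text \<open>Collects what independence uses about a summand, uniformly for all kinds. The last
  clause is the normalization at work; it exempts \<open>Polynomial\<close>, which has nonzero
  members although their multipliers have no poles.\<close>

lemma summand_multiplier:
  assumes "i \<in> summands n UNIV" "x \<in> complex_summand F i"
  shows "\<exists>q. curve_deriv x = q *s field_curve F \<and>
    (\<forall>\<beta> m. m < 0 \<and> laurent \<beta> q $$ m \<noteq> 0 \<longrightarrow> i = power_summand n \<beta> m) \<and>
    ((\<forall>\<beta> m. m < 0 \<longrightarrow> laurent \<beta> q $$ m = 0) \<longrightarrow> i \<noteq> Polynomial \<longrightarrow> x = 0)"
proof -
  have local: ?thesis
    if K: "finite K" "\<And>m. m \<in> K \<Longrightarrow> m < 0 \<and> i = power_summand n \<beta> m"
      and w: "normalized_integral \<beta> (local_multiplier \<beta> K c *s field_curve F) x" for \<beta> K c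
  proof (intro exI conjI allI impI)
    let ?q = "local_multiplier \<beta> K c"
    show "curve_deriv x = ?q *s field_curve F"
      using w by (simp add: normalized_integral_def)
    show "i = power_summand n \<gamma> m" if "m < 0 \<and> laurent \<gamma> ?q $$ m \<noteq> 0" for \<gamma> m
    proof -
      \<comment> \<open>Away from its centre, a local multiplier has no pole.\<close>
      have "\<gamma> = \<beta>"
        using that laurent_sum_other_nth unfolding local_multiplier_def by metis
      then show ?thesis
        using that K by (auto simp: laurent_local_multiplier split: if_splits)
    qed
    show "x = 0" if "\<forall>\<gamma> m. m < 0 \<longrightarrow> laurent \<gamma> ?q $$ m = 0"
    proof -
      \<comment> \<open>All exponents in \<open>K\<close> are negative, so vanishing negative
        coefficients at \<open>\<beta>\<close> leave nothing of the multiplier.\<close>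
      have "?q = 0"
      proof (rule ratfun_eqI[of \<beta>])
        fix k
        show "laurent \<beta> ?q $$ k = laurent \<beta> 0 $$ k"
        proof (cases "k \<in> K")
          case True
          then show ?thesis
            using that K by (metis fls_zero_nth laurent.lift_zero)
        qed (use K in \<open>simp add: laurent_local_multiplier\<close>)
      qed
      then show ?thesis
        using w normalized_integral_0_unique by simp
    qed
  qed
  show ?thesis
  proof (cases i)
    case Polynomial
    then have "x \<in> complex_polynomial_solutions F"
      using assms complex_summand_Polynomial by simp
    then show ?thesis
      using Polynomial by (auto simp: complex_polynomial_solutions_def laurent_poly_nth)
  next
    case (NonRegular \<beta>)
    then obtain c where
      "normalized_integral \<beta> (local_multiplier \<beta> {- int n - 1..- 1} c *s field_curve F) x"
      using assms by (auto simp: nonregular_curves_eq[OF degree])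
    then show ?thesis
      by (rule local[rotated 2]) (auto simp: NonRegular power_summand_def)
  next
    case (Regular \<beta> j)
    then obtain c where
      "normalized_integral \<beta> (local_multiplier \<beta> {j} c *s field_curve F) x"
      using assms by (auto simp: regular_curves_eq)
    then show ?thesis
      by (rule local[rotated 2]) (use assms Regular in \<open>auto simp: power_summand_def summands_def\<close>)
  qed
qed

text \<open>Since \<open>F\<close> is nonzero, the multipliers also add up to zero. A given power at
  a given point occurs in the multiplier of one summand only, so nothing cancels and every negative
  coefficient vanishes. This kills all summands but the polynomial one, which then equals the whole
  sum.\<close>

lemma complex_summands_independent:
  assumes J: "finite J" "J \<subseteq> summands n UNIV"
    and x: "\<And>i. i \<in> J \<Longrightarrow> x i \<in> complex_summand F i"
    and sum: "(\<Sum>i\<in>J. x i) = 0"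
    and "i \<in> J"
  shows "x i = 0"
proof -
  have "\<forall>i\<in>J. \<exists>q. curve_deriv (x i) = q *s field_curve F \<and>
    (\<forall>\<beta> m. m < 0 \<and> laurent \<beta> q $$ m \<noteq> 0 \<longrightarrow> i = power_summand n \<beta> m) \<and>
    ((\<forall>\<beta> m. m < 0 \<longrightarrow> laurent \<beta> q $$ m = 0) \<longrightarrow> i \<noteq> Polynomial \<longrightarrow> x i = 0)"
    using summand_multiplier J x by blast
  then obtain q where deriv: "\<And>i. i \<in> J \<Longrightarrow> curve_deriv (x i) = q i *s field_curve F"
    and pow: "\<And>i \<beta> m. \<lbrakk>i \<in> J; m < 0; laurent \<beta> (q i) $$ m \<noteq> 0\<rbrakk> \<Longrightarrow> i = power_summand n \<beta> m"
    and zero: "\<And>i. \<lbrakk>i \<in> J; \<forall>\<beta> m. m < 0 \<longrightarrow> laurent \<beta> (q i) $$ m = 0; i \<noteq> Polynomial\<rbrakk> \<Longrightarrow> x i = 0"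
    by metis
  have "(\<Sum>i\<in>J. q i) *s field_curve F = (\<Sum>i\<in>J. curve_deriv (x i))"
    by (simp add: deriv vec_eq_iff sum_distrib_right)
  also have "\<dots> = 0 *s field_curve F"
    using sum by (simp flip: curve_deriv_sum)
  finally have q_sum: "(\<Sum>i\<in>J. q i) = 0"
    using vmult_eq_iff[OF nonzero] by blast
  have coeffs: "laurent \<beta> (q i) $$ m = 0" if "i \<in> J" "m < 0" for i \<beta> m
  proof (rule ccontr)
    assume nz: "laurent \<beta> (q i) $$ m \<noteq> 0"
    then have "laurent \<beta> (q k) $$ m = 0" if "k \<in> J - {i}" for k
      using that pow \<open>i \<in> J\<close> \<open>m < 0\<close> by (metis Diff_iff singletonI)
    then have "(\<Sum>k\<in>J. laurent \<beta> (q k) $$ m) = laurent \<beta> (q i) $$ m"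
      using J \<open>i \<in> J\<close> by (simp add: sum.remove)
    moreover have "(\<Sum>k\<in>J. laurent \<beta> (q k) $$ m) = 0"
      using q_sum by (simp flip: fls_nth_sum laurent.lift_sum)
    ultimately show False
      using nz by simp
  qed
  then have nonpoly: "x k = 0" if "k \<in> J" "k \<noteq> Polynomial" for k
    using that zero by blast
  show ?thesis
  proof (cases "i = Polynomial")
    case True
    have "(\<Sum>k\<in>J. x k) = x i"
      using J \<open>i \<in> J\<close> nonpoly True by (simp add: sum.remove)
    then show ?thesis
      using sum by simp
  qed (use nonpoly \<open>i \<in> J\<close> in blast)
qed

lemma complex_summand_subset:
  assumes "i \<in> summands n UNIV"
  shows "complex_summand F i \<subseteq> complex_solutions F"
  using summand_multiplier[OF assms] unfolding complex_solutions_def by blast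

text \<open>Cutting the principal part at exponent \<open>- n - 1\<close> separates the powers that
  enter the residue of the product with \<open>F\<close> from those that do not. Each piece has zero
  residue and is integrated inside its own summand.\<close>

lemma principal_part_integral:
  assumes r: "curve_deriv r = q *s field_curve F"
  shows "\<exists>s \<in> complex_curves.span (\<Union>i\<in>summands n UNIV. complex_summand F i).
    curve_deriv s = principal_part \<beta> q *s field_curve F"
proof -
  let ?S = "complex_curves.span (\<Union>i\<in>summands n UNIV. complex_summand F i)"
  define c where "c m = laurent \<beta> q $$ m" for m
  define K where "K = {- int n - 1..- 1}"
  \<comment> \<open>\<open>K\<close> is the full range that \<open>NonRegular\<close> asks for,
    whereas \<open>M\<close> keeps only nonzero coefficients so as to be finite.\<close>
  define M where "M = {m. m < - int n - 1 \<and> c m \<noteq> 0}"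
  have fin: "finite M"
    by (rule finite_subset[OF _ finite_principal_exponents[of \<beta> q]]) (auto simp: M_def c_def)
  have pp: "principal_part \<beta> q = local_multiplier \<beta> K c + (\<Sum>m\<in>M. local_multiplier \<beta> {m} c)"
  proof (rule ratfun_eqI[of \<beta>])
    fix m
    have "laurent \<beta> (principal_part \<beta> q) $$ m = (if m < 0 then c m else 0)"
      by (auto simp: principal_part_def laurent_sum_nth[OF finite_principal_exponents] c_def)
    also have "\<dots> = (if m \<in> K then c m else 0) + (if m \<in> M then c m else 0)"
      by (auto simp: K_def M_def)
    also have "\<dots> = laurent \<beta> (local_multiplier \<beta> K c + (\<Sum>m\<in>M. local_multiplier \<beta> {m} c)) $$ m"
      using fin
      by (simp add: laurent.lift_add laurent.lift_sum fls_nth_sum laurent_local_multiplier K_def)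
    finally show "laurent \<beta> (principal_part \<beta> q) $$ m =
      laurent \<beta> (local_multiplier \<beta> K c + (\<Sum>m\<in>M. local_multiplier \<beta> {m} c)) $$ m" .
  qed
  have "(q *s field_curve F) $ i = fract_deriv (r $ i)" for i
    using r by (simp add: curve_deriv_def vec_eq_iff)
  then have "laurent \<beta> ((q *s field_curve F) $ i) $$ (- 1) = 0" for i
    by (simp add: laurent_deriv del: vector_smult_component)
  then have "(\<Sum>k\<le>n. c (- 1 - int k) *s taylor_coeff F \<beta> k) = 0"
    using residue_condition_iff degree unfolding c_def by blast
  \<comment> \<open>Only exponents in \<open>K\<close> enter the residue sum, so the constraint
    passes from \<open>q\<close> to this piece.\<close>
  then have "(\<Sum>k\<le>n. laurent \<beta> (local_multiplier \<beta> K c) $$ (- 1 - int k) *s taylor_coeff F \<beta> k) = 0"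
    by (simp add: laurent_local_multiplier K_def)
  then have "laurent \<beta> ((local_multiplier \<beta> K c *s field_curve F) $ i) $$ (- 1) = 0" for i
    using residue_condition_iff degree by blast
  then obtain w\<^sub>0 where w\<^sub>0: "normalized_integral \<beta> (local_multiplier \<beta> K c *s field_curve F) w\<^sub>0"
    using local_multiplier_integral[of K \<beta> c F] by (auto simp: K_def)
  then have "w\<^sub>0 \<in> complex_summand F (NonRegular \<beta>)"
    by (auto simp: nonregular_curves_eq[OF degree] K_def)
  then have w\<^sub>0_mem: "w\<^sub>0 \<in> ?S"
    by (intro complex_curves.span_base) (auto simp: summands_def)
  have "\<exists>w \<in> ?S. curve_deriv w = local_multiplier \<beta> {m} c *s field_curve F" if "m \<in> M" for m
  proof -
    \<comment> \<open>\<open>m < - n - 1\<close> is never of the form \<open>- 1 - k\<close> with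
      \<open>k \<le> n\<close>.\<close>
    have "laurent \<beta> (local_multiplier \<beta> {m} c) $$ (- 1 - int k) = 0" if "k \<le> n" for k
      using that \<open>m \<in> M\<close> by (auto simp: laurent_local_multiplier M_def)
    then have "(\<Sum>k\<le>n. laurent \<beta> (local_multiplier \<beta> {m} c) $$ (- 1 - int k) *s taylor_coeff F \<beta> k) = 0"
      by simp
    then have "laurent \<beta> ((local_multiplier \<beta> {m} c *s field_curve F) $ i) $$ (- 1) = 0" for i
      using residue_condition_iff degree by blast
    then obtain w where w: "normalized_integral \<beta> (local_multiplier \<beta> {m} c *s field_curve F) w"
      using local_multiplier_integral[of "{m}" \<beta> c F] by auto
    then have "w \<in> complex_summand F (Regular \<beta> m)"
      by (auto simp: regular_curves_eq)
    moreover have "Regular \<beta> m \<in> summands n UNIV"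
      using that by (auto simp: summands_def M_def)
    ultimately have "w \<in> ?S"
      by (intro complex_curves.span_base) blast
    then show ?thesis
      using w by (auto simp: normalized_integral_def)
  qed
  then obtain w where w: "\<And>m. m \<in> M \<Longrightarrow> w m \<in> ?S"
    "\<And>m. m \<in> M \<Longrightarrow> curve_deriv (w m) = local_multiplier \<beta> {m} c *s field_curve F"
    by metis
  have "w\<^sub>0 + (\<Sum>m\<in>M. w m) \<in> ?S"
    by (intro complex_curves.span_add complex_curves.span_sum w w\<^sub>0_mem)
  moreover have "curve_deriv w\<^sub>0 = local_multiplier \<beta> K c *s field_curve F"
    using w\<^sub>0 by (simp add: normalized_integral_def)
  then have "curve_deriv (w\<^sub>0 + (\<Sum>m\<in>M. w m)) = principal_part \<beta> q *s field_curve F"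
    by (simp add: curve_deriv_add curve_deriv_sum w(2) pp vec_eq_iff sum_distrib_right distrib_right)
  ultimately show ?thesis
    by blast
qed

lemma complex_solutions_eq_span:
  "complex_solutions F = complex_curves.span (\<Union>i\<in>summands n UNIV. complex_summand F i)"
  (is "_ = ?S")
proof (rule antisym)
  show "?S \<subseteq> complex_solutions F"
    using complex_summand_subset
    by (intro complex_curves.span_minimal subspace_complex_solutions) blast
  show "complex_solutions F \<subseteq> ?S"
  proof
    fix r
    assume "r \<in> complex_solutions F"
    then obtain q where q: "curve_deriv r = q *s field_curve F"
      by (auto simp: complex_solutions_def)
    obtain p B where pB: "q = to_fract p + (\<Sum>\<beta>\<in>B. principal_part \<beta> q)"
      using partial_fractions by blast
    obtain s where s: "\<And>\<beta>. s \<beta> \<in> ?S"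
      "\<And>\<beta>. curve_deriv (s \<beta>) = principal_part \<beta> q *s field_curve F"
      using principal_part_integral[OF q] by metis
    have "curve_deriv (r - (\<Sum>\<beta>\<in>B. s \<beta>)) = (q - (\<Sum>\<beta>\<in>B. principal_part \<beta> q)) *s field_curve F"
      by (simp add: curve_deriv_diff curve_deriv_sum q s(2) vec_eq_iff sum_distrib_right left_diff_distrib)
    also have "q - (\<Sum>\<beta>\<in>B. principal_part \<beta> q) = to_fract p"
      using pB by (metis add_diff_cancel_right')
    \<comment> \<open>Membership here depends on the derivative alone, so constants of integration
      end up in this summand.\<close>
    finally have "r - (\<Sum>\<beta>\<in>B. s \<beta>) \<in> complex_summand F Polynomial"
      unfolding complex_summand_Polynomial complex_polynomial_solutions_def by blast
    moreover have "Polynomial \<in> summands n UNIV"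
      by (simp add: summands_def)
    ultimately have "r - (\<Sum>\<beta>\<in>B. s \<beta>) \<in> ?S"
      by (intro complex_curves.span_base) blast
    moreover have "(\<Sum>\<beta>\<in>B. s \<beta>) \<in> ?S"
      by (intro complex_curves.span_sum s)
    ultimately have "(r - (\<Sum>\<beta>\<in>B. s \<beta>)) + (\<Sum>\<beta>\<in>B. s \<beta>) \<in> ?S"
      by (rule complex_curves.span_add)
    then show "r \<in> ?S"
      by simp
  qed
qed

lemma complex_direct_sum:
  "internal_direct_sum cscale
     (complexification (rational_curves F)) (summands n UNIV) (complex_summand F)"
  unfolding internal_direct_sum_def complexification_rational_curves[OF nonzero]
  using subspace_complex_summand complex_solutions_eq_span complex_summands_independent by blast

section \<open>The real decomposition\<close>

lemma curve_cnj_local_multiplier: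
  "curve_cnj (local_multiplier \<beta> K c *s field_curve F) =
     local_multiplier (cnj \<beta>) K (\<lambda>k. cnj (c k)) *s field_curve F"
  by (simp add: local_multiplier_def curve_cnj_vmult ratfun_cnj.lift_sum ratfun_cnj.lift_mult)

lemma curve_cnj_local_solution:
  assumes "x \<in> {w. \<exists>c. normalized_integral \<beta> (local_multiplier \<beta> K c *s field_curve F) w}"
  shows "curve_cnj x \<in>
    {w. \<exists>c. normalized_integral (cnj \<beta>) (local_multiplier (cnj \<beta>) K c *s field_curve F) w}"
proof -
  from assms obtain c where "normalized_integral \<beta> (local_multiplier \<beta> K c *s field_curve F) x"
    by blast
  from normalized_integral_cnj[OF this] show ?thesis
    unfolding curve_cnj_local_multiplier by blast
qed

lemma curve_cnj_complex_summand:
  assumes "x \<in> complex_summand F i"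
  shows "curve_cnj x \<in> complex_summand F (summand_cnj i)"
proof (cases i)
  case Polynomial
  then show ?thesis
    using assms curve_cnj_complex_polynomial_solutions[of x F]
    unfolding Polynomial summand_cnj.simps complex_summand_Polynomial by simp
next
  case (NonRegular \<beta>)
  then show ?thesis
    using assms curve_cnj_local_solution[of x \<beta> "{- int n - 1..- 1}"]
    by (simp add: nonregular_curves_eq[OF degree])
next
  case (Regular \<beta> j)
  then show ?thesis
    using assms curve_cnj_local_solution[of x \<beta> "{j}"] by (simp add: regular_curves_eq)
qed

text \<open>One formula serves all kinds: \<open>Polynomial\<close> is its own conjugate index, and
  a subspace equals its sum with itself.\<close>

lemma real_summand_eq:
  "real_summand F i =
     {r. real_curve r \<and> (\<exists>v\<in>complex_summand F i. \<exists>w\<in>complex_summand F (summand_cnj i). r = v + w)}"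
proof (cases i)
  case Polynomial
  let ?P = "complex_polynomial_solutions F"
  have "(\<exists>v\<in>?P. \<exists>w\<in>?P. r = v + w) \<longleftrightarrow> r \<in> ?P" for r
  proof
    assume "r \<in> ?P"
    moreover have "0 \<in> ?P" "r = r + 0"
      by (simp_all add: complex_curves.subspace_0 subspace_complex_polynomial_solutions)
    ultimately show "\<exists>v\<in>?P. \<exists>w\<in>?P. r = v + w"
      by blast
  qed (use complex_curves.subspace_add[OF subspace_complex_polynomial_solutions] in blast)
  then show ?thesis
    unfolding Polynomial summand_cnj.simps complex_summand_Polynomial real_summand.simps
      polynomial_curves_eq[OF nonzero] by blast
qed (simp_all add: real_points_def)

text \<open>Exchanging \<open>v\<close> and \<open>w\<close> exchanges the two conjugate indices;
  this is why one index per conjugate pair is enough.\<close>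

lemma real_summand_cnj: "real_summand F (summand_cnj i) = real_summand F i"
  unfolding real_summand_eq summand_cnj_cnj
  by (intro Collect_cong conj_cong refl) (metis add.commute)

lemma real_part_complex_summand:
  assumes "x \<in> complex_summand F i"
  shows "real_part x \<in> real_summand F i"
proof -
  have "cscale (1 / 2) x \<in> complex_summand F i"
    "cscale (1 / 2) (curve_cnj x) \<in> complex_summand F (summand_cnj i)"
    using assms curve_cnj_complex_summand
    by (simp_all add: complex_curves.subspace_scale[OF subspace_complex_summand])
  then show ?thesis
    using real_curve_real_part[of x]
    by (auto simp: real_summand_eq real_part_def complex_curves.scale_right_distrib)
qed

lemma real_curve_add:
  assumes "real_curve x" "real_curve y"
  shows "real_curve (x + y)"
  using assms by (simp add: real_curve_iff curve_cnj_add)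

lemma real_curve_rscale:
  assumes "real_curve x"
  shows "real_curve (rscale c x)"
  using assms by (simp add: real_curve_iff rscale_def curve_cnj_cscale)

lemma real_subspace_real_curves:
  assumes "complex_curves.subspace V"
  shows "real_curves.subspace {x \<in> V. real_curve x}"
proof (rule real_curves.subspaceI)
  show "0 \<in> {x \<in> V. real_curve x}"
    using assms by (simp add: complex_curves.subspace_0 real_curve_iff)
qed (use assms in \<open>simp_all add: complex_curves.subspace_add real_curve_add real_curve_rscale
    rscale_def complex_curves.subspace_scale real_curve_rscale[unfolded rscale_def]\<close>)

lemma subspace_real_summand: "real_curves.subspace (real_summand F i)"
proof -
  let ?V = "{v + w | v w. v \<in> complex_summand F i \<and> w \<in> complex_summand F (summand_cnj i)}"
  have "complex_curves.subspace ?V"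
    by (rule complex_curves.subspace_sums[OF subspace_complex_summand subspace_complex_summand])
  then have "real_curves.subspace {r \<in> ?V. real_curve r}"
    by (rule real_subspace_real_curves)
  moreover have "real_summand F i = {r \<in> ?V. real_curve r}"
    unfolding real_summand_eq by blast
  ultimately show ?thesis
    by (simp only:)
qed

lemma upper_summand_cases:
  assumes "i \<in> summands n UNIV"
  shows "i \<in> summands n {\<beta>. Im \<beta> \<ge> 0} \<or> summand_cnj i \<in> summands n {\<beta>. Im \<beta> \<ge> 0}"
  using assms by (cases i) (simp_all add: linear)

text \<open>A point that lies with its conjugate in the closed upper half-plane is real.\<close>

lemma upper_summand_cnj_fixed:
  assumes "i \<in> summands n {\<beta>. Im \<beta> \<ge> 0}" "summand_cnj i \<in> summands n {\<beta>. Im \<beta> \<ge> 0}"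
  shows "summand_cnj i = i"
  using assms by (cases i) (simp_all add: complex_eq_iff)

text \<open>Spanning is transferred from the complex decomposition by taking real parts, as a real
  curve is its own real part.\<close>

lemma rational_curves_eq_span:
  "rational_curves F =
     real_curves.span (\<Union>i\<in>summands n {\<beta>. Im \<beta> \<ge> 0}. real_summand F i)"
  (is "_ = ?S")
proof (rule antisym)
  have "real_summand F i \<subseteq> rational_curves F" if "i \<in> summands n {\<beta>. Im \<beta> \<ge> 0}" for i
  proof -
    have "i \<in> summands n UNIV"
      using that by (auto simp: summands_def)
    then have "complex_summand F i \<subseteq> complex_solutions F"
      "complex_summand F (summand_cnj i) \<subseteq> complex_solutions F"
      using complex_summand_subset summand_cnj_in_summands by blast+
    then show ?thesis
      unfolding real_summand_eq rational_curves_eq[OF nonzero]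
      using complex_curves.subspace_add[OF subspace_complex_solutions] by blast
  qed
  then show "?S \<subseteq> rational_curves F"
    unfolding rational_curves_eq[OF nonzero]
    by (intro real_curves.span_minimal real_subspace_real_curves subspace_complex_solutions) blast
next
  \<comment> \<open>\<open>real_part\<close> is not complex linear; quantifying over all complex
    factors \<open>c\<close> makes \<open>T\<close> a complex subspace, so that minimality of the
    complex span applies.\<close>
  define T where "T = {x. \<forall>c. real_part (cscale c x) \<in> ?S}"
  have "complex_curves.subspace T"
    by (rule complex_curves.subspaceI)
      (auto simp: T_def complex_curves.scale_right_distrib real_part_add
        intro: real_curves.span_add real_curves.span_zero)
  moreover have "complex_summand F i \<subseteq> T" if i: "i \<in> summands n UNIV" for i
  proof
    fix x
    assume x: "x \<in> complex_summand F i"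
    have "real_part (cscale c x) \<in> real_summand F i" for c
      by (intro real_part_complex_summand complex_curves.subspace_scale[OF subspace_complex_summand] x)
    \<comment> \<open>An index in the lower half-plane is replaced by its conjugate, which has the
      same real summand.\<close>
    then have "real_part (cscale c x) \<in> (\<Union>i\<in>summands n {\<beta>. Im \<beta> \<ge> 0}. real_summand F i)" for c
      using upper_summand_cases[OF i] real_summand_cnj by blast
    then show "x \<in> T"
      by (simp add: T_def real_curves.span_base)
  qed
  ultimately have T: "complex_solutions F \<subseteq> T"
    unfolding complex_solutions_eq_span by (intro complex_curves.span_minimal) blast
  show "rational_curves F \<subseteq> ?S"
  proof
    fix r
    assume "r \<in> rational_curves F"
    then have "r \<in> T" "real_curve r"
      using T by (auto simp: rational_curves_eq[OF nonzero])
    then have "real_part (cscale 1 r) \<in> ?S"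
      unfolding T_def by blast
    then show "r \<in> ?S"
      using \<open>real_curve r\<close> by (simp add: real_part_of_real)
  qed
qed

text \<open>Each real curve is split into its parts in the two conjugate complex summands, which
  reduces the claim to complex independence.\<close>

lemma real_summands_independent:
  assumes J: "finite J" "J \<subseteq> summands n {\<beta>. Im \<beta> \<ge> 0}"
    and x: "\<And>i. i \<in> J \<Longrightarrow> x i \<in> real_summand F i"
    and sum: "(\<Sum>i\<in>J. x i) = 0"
    and "i \<in> J"
  shows "x i = 0"
proof -
  have "\<forall>i\<in>J. \<exists>v w. v \<in> complex_summand F i \<and> w \<in> complex_summand F (summand_cnj i) \<and> x i = v + w"
    using x unfolding real_summand_eq by blast
  then obtain v w where v: "\<And>i. i \<in> J \<Longrightarrow> v i \<in> complex_summand F i"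
    and w: "\<And>i. i \<in> J \<Longrightarrow> w i \<in> complex_summand F (summand_cnj i)"
    and vw: "\<And>i. i \<in> J \<Longrightarrow> x i = v i + w i"
    by metis
  let ?J' = "summand_cnj ` J"
  \<comment> \<open>Collects the parts by complex summand. At a self-conjugate index both parts land
    in the same summand and are added.\<close>
  define y where "y k = (if k \<in> J then v k else 0) + (if k \<in> ?J' then w (summand_cnj k) else 0)" for k
  have fin: "finite (J \<union> ?J')"
    using J by simp
  have "J \<subseteq> summands n UNIV"
    using J by (auto simp: summands_def)
  then have sub: "J \<union> ?J' \<subseteq> summands n UNIV"
    using summand_cnj_in_summands by blast
  have y: "y k \<in> complex_summand F k" for k
  proof -
    have "w (summand_cnj k) \<in> complex_summand F k" if "k \<in> ?J'"
      using that w by force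
    then show ?thesis
      unfolding y_def using v complex_curves.subspace_0[OF subspace_complex_summand]
      by (intro complex_curves.subspace_add[OF subspace_complex_summand]) auto
  qed
  have inj: "inj_on summand_cnj J"
    by (metis inj_onI summand_cnj_cnj)
  have "(\<Sum>k\<in>J \<union> ?J'. y k) = (\<Sum>k\<in>J. v k) + (\<Sum>k\<in>?J'. w (summand_cnj k))"
    using fin unfolding y_def sum.distrib
    by (simp add: sum.If_cases Int_absorb1)
  also have "\<dots> = (\<Sum>i\<in>J. x i)"
    by (simp add: sum.reindex[OF inj] vw sum.distrib)
  finally have "(\<Sum>k\<in>J \<union> ?J'. y k) = 0"
    using sum by simp
  then have y0: "y k = 0" if "k \<in> J \<union> ?J'" for k
    using complex_summands_independent[OF fin sub, of y] y that by blast
  \<comment> \<open>If the conjugate index lies in \<open>J\<close>, it equals \<open>i\<close> and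
    \<open>y i\<close> is \<open>x i\<close>; otherwise \<open>v i\<close> and \<open>w i\<close>
    sit at different indices and vanish separately.\<close>
  show ?thesis
  proof (cases "summand_cnj i \<in> J")
    case True
    then have fixed: "summand_cnj i = i"
      using upper_summand_cnj_fixed J \<open>i \<in> J\<close> by blast
    then have "i \<in> ?J'"
      using \<open>i \<in> J\<close> by (metis imageI)
    then have "y i = x i"
      using fixed \<open>i \<in> J\<close> by (simp add: y_def vw)
    then show ?thesis
      using y0 \<open>i \<in> J\<close> by simp
  next
    case False
    then have "i \<notin> ?J'"
      by force
    then have "y i = v i"
      using \<open>i \<in> J\<close> by (simp add: y_def)
    moreover have "y (summand_cnj i) = w i"
      using False \<open>i \<in> J\<close> by (simp add: y_def)
    ultimately show ?thesis
      using y0 \<open>i \<in> J\<close> vw by (metis UnI1 UnI2 add.right_neutral imageI)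
  qed
qed

lemma real_direct_sum:
  "internal_direct_sum rscale
     (rational_curves F) (summands n {\<beta>. Im \<beta> \<ge> 0}) (real_summand F)"
  unfolding internal_direct_sum_def
  using subspace_real_summand rational_curves_eq_span real_summands_independent by blast

end

theorem theorem2p3:
  fixes F :: "real poly ^ 3" and n :: nat
  assumes degree: "field_degree F = n"
    and spatial: "truly_spatial F"
    and primitive: "no_common_factor F"
  shows "internal_direct_sum cscale
           (complexification (rational_curves F)) (summands n UNIV) (complex_summand F) \<and>
         internal_direct_sum rscale
           (rational_curves F) (summands n {\<beta>. Im \<beta> \<ge> 0}) (real_summand F)"
  using complex_direct_sum[OF degree field_curve_nonzero[OF spatial]]
    real_direct_sum[OF degree field_curve_nonzero[OF spatial]] ..

end
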